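(* Let $\mathbb{X}=\mathbb{R}^d$ and let $\{\mu_i\}_{i=1}^m$ be a sequence of absolutely continuous probability measures in $\mathcal{P}_2(\mathbb{X})$. For $A\in M(d)$ put $$F(A)=\sum_{i=1}^{m-1} W_2^2\big((Ax)_{\#}\mu_i,\ \mu_{i+1}\big).$$ If a minimizer $A\in M(d)$ of $F$ over $M(d)$ exists and is nonsingular, then for each $i\in\{1,\ldots,m-1\}$ there exists a unique $\eta_i\in\Pi(\mu_i,\mu_{i+1})$, a measure in the variables $(x_i,x_{i+1})\in\mathbb{X}\times\mathbb{X}$, such that $$(Ax_i,x_{i+1})_{\#}\eta_i\in\Pi^*\big((Ax_i)_{\#}\mu_i,\ \mu_{i+1}\big),$$ and moreover $A$ satisfies $$\sum_{i=1}^{m-1}\int_{\mathbb{X}\times\mathbb{X}}(Ax_i-x_{i+1})\,x_i^T\,d\eta_i(x_i,x_{i+1})=0.$$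
   Context: $M(d)$ is the space of real $d\times d$ matrices. $\mathcal{P}_2(\mathbb{X})$ is the set of Borel probability measures on $\mathbb{X}=\mathbb{R}^d$ with finite second moments; absolute continuity is with respect to Lebesgue measure. For a measurable map $S$, the push-forward $S_{\#}\nu$ is defined by $S_{\#}\nu(B)=\nu(S^{-1}(B))$ for Borel $B$. The notation $(Ax)_{\#}\mu$ means the push-forward of $\mu$ by the map $x\mapsto Ax$, and $(Ax_i,x_{i+1})_{\#}\eta_i$ means the push-forward of $\eta_i$ by the map $(x_i,x_{i+1})\mapsto(Ax_i,x_{i+1})$ on $\mathbb{X}\times\mathbb{X}$. $\Pi(\mu,\nu)$ is the set of couplings, i.e. probability measures on $\mathbb{X}\times\mathbb{X}$ with first marginal $\mu$ and second marginal $\nu$. The Wasserstein distance $W_2$ is given by $W_2^2(\mu,\nu)=\inf_{\pi\in\Pi(\mu,\nu)}\int_{\mathbb{X}\times\mathbb{X}}\|x-y\|^2\,d\pi(x,y)$, with $\|\cdot\|$ the Euclidean norm, and $\Pi^*(\mu,\nu)$ is the set of couplings attaining this infimum. Vectors are columns, so $(Ax_i-x_{i+1})x_i^T$ is a $d\times d$ matrix and the integral is entrywise. *)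

theory Defs
  imports "HOL-Probability.Probability"
begin

(* Real type-indexed vectors real^'d render R^d, with d = CARD('d); matrices are real^'d^'d. *)

definition P2 :: "(real^'d) measure set" where
  "P2 = {\<mu>. prob_space \<mu> \<and> sets \<mu> = sets borel \<and> (\<integral>\<^sup>+ x. ennreal ((norm x)\<^sup>2) \<partial>\<mu>) < \<infinity>}"

definition couplings ::
    "(real^'d) measure \<Rightarrow> (real^'d) measure \<Rightarrow> ((real^'d) \<times> (real^'d)) measure set" where
  "couplings \<mu> \<nu> = {\<pi>. prob_space \<pi> \<and> sets \<pi> = sets borel \<and>
     distr \<pi> borel fst = \<mu> \<and> distr \<pi> borel snd = \<nu>}"

definition transport_cost :: "((real^'d) \<times> (real^'d)) measure \<Rightarrow> ennreal" where
  "transport_cost \<pi> = (\<integral>\<^sup>+ (x, y). ennreal ((norm (x - y))\<^sup>2) \<partial>\<pi>)"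

(* On P2 the infimum is finite, so the conversion enn2real loses no information there. *)
definition W2 :: "(real^'d) measure \<Rightarrow> (real^'d) measure \<Rightarrow> real" where
  "W2 \<mu> \<nu> = sqrt (enn2real (INF \<pi>\<in>couplings \<mu> \<nu>. transport_cost \<pi>))"

definition optimal_couplings ::
    "(real^'d) measure \<Rightarrow> (real^'d) measure \<Rightarrow> ((real^'d) \<times> (real^'d)) measure set" where
  "optimal_couplings \<mu> \<nu> = {\<pi> \<in> couplings \<mu> \<nu>.
     transport_cost \<pi> = (INF \<pi>'\<in>couplings \<mu> \<nu>. transport_cost \<pi>')}"

definition push :: "real^'d^'d \<Rightarrow> (real^'d) measure \<Rightarrow> (real^'d) measure" where
  "push A \<mu> = distr \<mu> borel (\<lambda>x. A *v x)"

definition push_fst ::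
    "real^'d^'d \<Rightarrow> ((real^'d) \<times> (real^'d)) measure \<Rightarrow> ((real^'d) \<times> (real^'d)) measure" where
  "push_fst A \<eta> = distr \<eta> borel (\<lambda>(x, y). (A *v x, y))"

definition F :: "nat \<Rightarrow> (nat \<Rightarrow> (real^'d) measure) \<Rightarrow> real^'d^'d \<Rightarrow> real" where
  "F m \<mu> A = (\<Sum>i\<in>{1..<m}. (W2 (push A (\<mu> i)) (\<mu> (Suc i)))\<^sup>2)"

(* The matrix u v^T for column vectors u and v. *)
definition outer_product :: "real^'d \<Rightarrow> real^'d \<Rightarrow> real^'d^'d" where
  "outer_product u v = (\<chi> j k. u $ j * v $ k)"

definition matrix_integral :: "'a measure \<Rightarrow> ('a \<Rightarrow> real^'d^'d) \<Rightarrow> real^'d^'d" where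
  "matrix_integral M f = (\<chi> j k. \<integral> z. f z $ j $ k \<partial>M)"

end

(*
  A coupling eta of mu_i and mu_(i+1) is the same thing as the coupling (Ax, y)_# eta of (Ax)_# mu_i
  and mu_(i+1), because A is invertible; so the first claim is existence and uniqueness of optimal
  couplings for an absolutely continuous source.

  Existence.  By Tychonoff, the values of a minimising sequence of couplings on all Borel sets cluster
  at a finitely additive set function.  On the ring generated by measurable rectangles it is continuous
  at the empty set, since the fixed marginals are inner regular; Caratheodory yields a coupling, and it
  charges open sets no more than the set function does, which makes the cost lower semicontinuous.

  Uniqueness.  Let (x, y), (x', y') be independent with an optimal law pi, and exchange y and y' when
  (x - x') . (y - y') < 0.  By symmetry the law of the first pair is again a coupling, so optimality
  forces (x - x') . (y - y') >= 0 almost surely, and the support of pi is a closed monotone relation.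
  Along a line in direction e_k, the intervals between two k-th coordinates of values at one point are
  disjoint for different points, so the points with several values form a null set by Fubini.
  Hence pi is determined by its first marginal and its support; apply this to the midpoint of two
  optimal couplings.

  First order condition.  F(B) is at most the sum of the integrals of |Bx - y|^2 with respect to eta_i,
  with equality at B = A; this quadratic function of B is therefore minimal at A.
*)
theory Submission
  imports Defs
begin

section \<open>Existence of optimal couplings\<close>

lemma rect_borel:
  fixes E :: "'a::second_countable_topology set" and F :: "'b::second_countable_topology set"
  assumes "E \<in> sets borel" "F \<in> sets borel"
  shows "E \<times> F \<in> sets borel"
  using assms by (simp flip: borel_prod)

text \<open>Each measure is a point of the cube of all functions from sets to [0, 1], which is
  compact by Tychonoff. The cube need not be sequentially compact, hence a filter \<open>G\<close>
  instead of a subsequence. Since one \<open>G\<close> serves all sets at once, \<open>m\<close>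
  inherits finite additivity and fixed marginals; countable additivity may be lost.\<close>

lemma setwise_cluster:
  fixes P :: "nat \<Rightarrow> 'a measure"
  assumes P: "\<And>n. prob_space (P n)"
  obtains G m where "G \<noteq> bot" "G \<le> sequentially" "\<And>B. ((\<lambda>n. measure (P n) B) \<longlongrightarrow> m B) G"
proof -
  let ?K = "PiE UNIV (\<lambda>B :: 'a set. {0..1 :: real})"
  let ?\<Phi> = "\<lambda>n. measure (P n)"
  have "compactin (product_topology (\<lambda>_ :: 'a set. euclidean :: real topology) UNIV) ?K"
    unfolding compactin_PiE by auto
  then have K: "compact ?K"
    by (simp add: euclidean_product_topology)
  have "eventually (\<lambda>f. f \<in> ?K) (filtermap ?\<Phi> sequentially)"
    unfolding eventually_filtermap using P by (auto intro!: always_eventually prob_space.prob_le_1)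
  moreover have "filtermap ?\<Phi> sequentially \<noteq> bot"
    by (simp add: filtermap_bot_iff)
  ultimately obtain m where m: "inf (nhds m) (filtermap ?\<Phi> sequentially) \<noteq> bot"
    using K unfolding compact_filter by blast
  \<comment> \<open>The neighbourhoods of \<open>m\<close> are pulled back to the indices: this is
    passing to a convergent subnet, and \<open>G\<close> is proper because \<open>m\<close> is a
    cluster point.\<close>
  define G where "G = inf (filtercomap ?\<Phi> (nhds m)) sequentially"
  have "G \<noteq> bot"
  proof
    assume "G = bot"
    then have "eventually (\<lambda>_. False) G" by simp
    then obtain Q where "eventually Q (nhds m)" "eventually (\<lambda>n. \<not> Q (?\<Phi> n)) sequentially"
      unfolding G_def eventually_inf eventually_filtercomap by (smt (verit) eventually_mono)
    then have "eventually (\<lambda>f. \<not> Q f) (filtermap ?\<Phi> sequentially)" "eventually Q (nhds m)"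
      by (simp_all add: eventually_filtermap)
    then have "eventually (\<lambda>f. \<not> Q f) (inf (nhds m) (filtermap ?\<Phi> sequentially))"
      "eventually Q (inf (nhds m) (filtermap ?\<Phi> sequentially))"
      by (blast intro: filter_leD[OF inf_le1] filter_leD[OF inf_le2])+
    then have "eventually (\<lambda>_. False) (inf (nhds m) (filtermap ?\<Phi> sequentially))"
      by (rule eventually_elim2) simp
    with m show False by (simp add: trivial_limit_def)
  qed
  moreover have "G \<le> sequentially" by (simp add: G_def)
  moreover have "((\<lambda>n. measure (P n) B) \<longlongrightarrow> m B) G" for B
  proof -
    have "(?\<Phi> \<longlongrightarrow> m) G"
      unfolding G_def by (metis filterlim_filtercomap filterlim_mono inf_le1 order_refl)
    moreover have "continuous_on UNIV (\<lambda>f :: 'a set \<Rightarrow> real. f B)"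
      by (rule continuous_on_product_coordinates)
    ultimately show ?thesis
      using continuous_on_tendsto_compose[of UNIV "\<lambda>f. f B" ?\<Phi> m G] by simp
  qed
  ultimately show thesis using that by blast
qed

section \<open>Countably additive extension from measurable rectangles\<close>

lemma semiring_of_sets_rectangles:
  "semiring_of_sets UNIV {E \<times> F | E F. E \<in> sets (borel :: 'a::topological_space measure) \<and>
     F \<in> sets (borel :: 'b::topological_space measure)}" (is "semiring_of_sets UNIV ?R")
proof
  show "?R \<subseteq> Pow UNIV" by simp
  show "{} \<in> ?R" by force
next
  fix a b assume "a \<in> ?R" "b \<in> ?R"
  then obtain E F E' F' where ab: "a = E \<times> F" "b = E' \<times> F'" and
    [measurable]: "E \<in> sets borel" "F \<in> sets borel" "E' \<in> sets borel" "F' \<in> sets borel" by blast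
  show "a \<inter> b \<in> ?R"
    unfolding ab Times_Int_Times by (auto intro!: exI[of _ "E \<inter> E'"] exI[of _ "F \<inter> F'"])
  show "\<exists>C\<subseteq>?R. finite C \<and> disjoint C \<and> a - b = \<Union> C"
  \<comment> \<open>The difference splits into the part over \<open>E - E'\<close> and, over
    \<open>E \<inter> E'\<close>, the part outside \<open>F'\<close>.\<close>
  proof (intro exI[of _ "{(E - E') \<times> F, (E \<inter> E') \<times> (F - F')}"] conjI)
    have "(E - E') \<times> F \<in> ?R" "(E \<inter> E') \<times> (F - F') \<in> ?R"
      by (intro CollectI exI conjI, rule refl, simp_all add: sets.Diff sets.Int)+
    then show "{(E - E') \<times> F, (E \<inter> E') \<times> (F - F')} \<subseteq> ?R" by blast
  qed (auto simp: ab disjoint_def)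
qed

text \<open>Inner regularity of finite Borel measures on Polish spaces, phrased with a real-valued
  defect so that defects can be added up.\<close>

lemma compact_subset_small_diff:
  fixes M :: "'a::polish_space measure"
  assumes "prob_space M" "sets M = sets borel" "E \<in> sets borel" "e > 0"
  obtains K where "K \<subseteq> E" "compact K" "measure M (E - K) < e"
proof -
  interpret M: prob_space M by fact
  have eq: "emeasure M E = (SUP K \<in> {K. K \<subseteq> E \<and> compact K}. emeasure M K)"
    using assms by (intro inner_regular) (auto simp: M.emeasure_space_1)
  \<comment> \<open>When \<open>E\<close> itself has mass below \<open>e\<close>, the empty set will
    do; otherwise \<open>measure M E - e\<close> is nonnegative and passes to \<open>ennreal\<close>
    without truncation.\<close>
  show thesis
  proof (cases "measure M E < e")
    case True
    then show thesis using that[of "{}"] by simp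
  next
    case False
    have "ennreal (measure M E - e) < (SUP K \<in> {K. K \<subseteq> E \<and> compact K}. emeasure M K)"
      unfolding eq[symmetric] using False assms by (simp add: M.emeasure_eq_measure ennreal_lessI)
    then obtain K where K: "K \<subseteq> E" "compact K" "ennreal (measure M E - e) < emeasure M K"
      unfolding less_SUP_iff by auto
    then have "measure M E - e < measure M K"
      using False by (simp add: M.emeasure_eq_measure ennreal_less_iff)
    moreover have "K \<in> sets M" using K assms by (simp add: compact_imp_closed)
    ultimately show thesis using K assms by (intro that[of K]) (auto simp: M.finite_measure_Diff)
  qed
qed

text \<open>Tightness of the marginals makes \<open>m\<close> continuous at the empty set on the
  ring of finite unions of rectangles, so Caratheodory applies there. The result agrees with
  \<open>m\<close> on that ring, but in general not beyond it. An open set is an increasing union of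
  a sequence from the ring, which leaves the inequality in the direction that lower semicontinuity
  of the cost requires.\<close>

lemma coupling_extension:
  fixes m :: "('a::polish_space \<times> 'b::polish_space) set \<Rightarrow> real"
  assumes \<mu>: "prob_space \<mu>" "sets \<mu> = sets borel" and \<nu>: "prob_space \<nu>" "sets \<nu> = sets borel"
    and nonneg: "\<And>A. A \<in> sets borel \<Longrightarrow> 0 \<le> m A"
    and add: "\<And>A B. A \<in> sets borel \<Longrightarrow> B \<in> sets borel \<Longrightarrow> A \<inter> B = {} \<Longrightarrow> m (A \<union> B) = m A + m B"
    and m1: "\<And>E. E \<in> sets borel \<Longrightarrow> m (E \<times> UNIV) = measure \<mu> E"
    and m2: "\<And>F. F \<in> sets borel \<Longrightarrow> m (UNIV \<times> F) = measure \<nu> F"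
  obtains \<pi> where "prob_space \<pi>" "sets \<pi> = sets borel" "distr \<pi> borel fst = \<mu>" "distr \<pi> borel snd = \<nu>"
    "\<And>U. open U \<Longrightarrow> measure \<pi> U \<le> m U"
proof -
  let ?R = "{E \<times> F | E F. E \<in> sets (borel :: 'a measure) \<and> F \<in> sets (borel :: 'b measure)}"
  interpret R: semiring_of_sets UNIV ?R by (rule semiring_of_sets_rectangles)
  define Q where "Q = R.generated_ring"
  interpret Q: ring_of_sets UNIV Q unfolding Q_def by (rule R.generating_ring)
  interpret \<mu>: prob_space \<mu> by fact
  interpret \<nu>: prob_space \<nu> by fact
  have R_borel: "A \<in> sets borel" if "A \<in> ?R" for A
    using that by (auto intro: rect_borel)
  have Q_borel: "A \<in> sets borel" if "A \<in> Q" for A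
  proof -
    obtain C where "finite C" "C \<subseteq> ?R" "A = \<Union>C"
      using \<open>A \<in> Q\<close> unfolding Q_def by (auto elim: R.generated_ringE)
    then show ?thesis using R_borel by (auto intro!: sets.finite_Union)
  qed
  have mono: "m A \<le> m B" if "A \<subseteq> B" "A \<in> sets borel" "B \<in> sets borel" for A B
    using add[of A "B - A"] nonneg[of "B - A"] that by (auto simp: Un_absorb1)
  have m0: "m {} = 0" using add[of "{}" "{}"] by simp
  have subadd: "m (A \<union> B) \<le> m A + m B" if "A \<in> sets borel" "B \<in> sets borel" for A B
    using add[of A "B - A"] mono[of "B - A" B] that by auto
  have subadd_fin: "m (\<Union>i\<in>I. A i) \<le> (\<Sum>i\<in>I. m (A i))"
    if "finite I" "\<And>i. i \<in> I \<Longrightarrow> A i \<in> sets borel" for I :: "'c set" and A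
    using that
  proof (induction I)
    case (insert i I)
    have "m (\<Union>j\<in>insert i I. A j) \<le> m (A i) + m (\<Union>j\<in>I. A j)"
      using subadd[of "A i" "\<Union>j\<in>I. A j"] insert by (simp add: sets.finite_UN)
    also have "\<dots> \<le> m (A i) + (\<Sum>j\<in>I. m (A j))" using insert by simp
    finally show ?case using insert by simp
  qed (simp add: m0)
  \<comment> \<open>What \<open>K \<times> L\<close> misses of \<open>E \<times> F\<close> lies in
    the strips over \<open>E - K\<close> and \<open>F - L\<close>, and \<open>m\<close> of a strip
    is a marginal mass.\<close>
  have inner_R: "\<exists>K. K \<subseteq> A \<and> compact K \<and> m (A - K) < e" if AR: "A \<in> ?R" and "e > 0" for A e
  proof -
    obtain E F where A: "A = E \<times> F" and [measurable]: "E \<in> sets borel" "F \<in> sets borel" using AR by blast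
    obtain K where K: "K \<subseteq> E" "compact K" "measure \<mu> (E - K) < e / 2"
      by (rule compact_subset_small_diff[of \<mu> E "e / 2"]) (use \<mu> \<open>e > 0\<close> in auto)
    obtain L where L: "L \<subseteq> F" "compact L" "measure \<nu> (F - L) < e / 2"
      by (rule compact_subset_small_diff[of \<nu> F "e / 2"]) (use \<nu> \<open>e > 0\<close> in auto)
    have [measurable]: "K \<in> sets borel" "L \<in> sets borel" using K L by (auto simp: compact_imp_closed)
    have 1: "(E - K) \<times> (UNIV :: 'b set) \<in> sets borel" "(UNIV :: 'a set) \<times> (F - L) \<in> sets borel"
      "E \<times> F - K \<times> L \<in> sets borel"
      by (auto intro!: rect_borel sets.Diff)
    have "m (A - K \<times> L) \<le> m ((E - K) \<times> UNIV \<union> UNIV \<times> (F - L))"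
      using 1 unfolding A by (intro mono) auto
    also have "\<dots> \<le> m ((E - K) \<times> UNIV) + m (UNIV \<times> (F - L))" using 1 by (intro subadd)
    also have "\<dots> < e" using K L by (simp add: m1 m2)
    finally show ?thesis using K L A by (intro exI[of _ "K \<times> L"]) (auto intro: compact_Times)
  qed
  have inner_Q: "\<exists>K. K \<subseteq> A \<and> compact K \<and> m (A - K) < e" if AQ: "A \<in> Q" and "e > 0" for A e
  proof -
    obtain C where C: "finite C" "C \<subseteq> ?R" "A = \<Union>C"
      using AQ unfolding Q_def by (auto elim: R.generated_ringE)
    \<comment> \<open>The extra 1 covers an empty \<open>C\<close> and keeps the total error
      strictly below \<open>e\<close>.\<close>
    have "e / (1 + card C) > 0" using \<open>e > 0\<close> by simp
    then have "\<forall>c\<in>C. \<exists>K. K \<subseteq> c \<and> compact K \<and> m (c - K) < e / (1 + card C)"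
      using C(2) by (intro ballI inner_R) (rule subsetD)
    then obtain k where k: "\<And>c. c \<in> C \<Longrightarrow> k c \<subseteq> c \<and> compact (k c) \<and> m (c - k c) < e / (1 + card C)"
      by metis
    let ?K = "\<Union>c\<in>C. k c"
    have kb: "c - k c \<in> sets borel" if "c \<in> C" for c
    proof -
      have "c \<in> sets borel" using C that R_borel by blast
      then show ?thesis using k[OF that] borel_compact by (auto intro!: sets.Diff)
    qed
    have "compact ?K" using C k by (intro compact_UN) auto
    moreover have "m (A - ?K) \<le> m (\<Union>c\<in>C. c - k c)"
    proof (rule mono)
      show "A - ?K \<in> sets borel"
        using borel_compact[OF \<open>compact ?K\<close>] Q_borel[OF \<open>A \<in> Q\<close>] by (rule sets.Diff[rotated])
    qed (use C kb in \<open>auto intro: sets.finite_UN\<close>)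
    moreover have "\<dots> \<le> (\<Sum>c\<in>C. m (c - k c))" using C kb by (intro subadd_fin) auto
    moreover have "\<dots> \<le> (\<Sum>c\<in>C. e / (1 + card C))" using k by (intro sum_mono less_imp_le) auto
    moreover have "\<dots> < e" using \<open>e > 0\<close> by (simp add: field_simps)
    ultimately show ?thesis using C k by (intro exI[of _ ?K]) auto
  qed
  \<comment> \<open>Choose compact \<open>k i\<close> inside \<open>A i\<close> with errors summing
    to less than \<open>e\<close>. They have empty intersection, so finitely many of them already
    do, and then some \<open>A N\<close> is covered by finitely many of the errors.\<close>
  have fin: "(\<lambda>i. ennreal (m (A i))) \<longlonglongrightarrow> 0"
    if A: "range A \<subseteq> Q" "decseq A" "(\<Inter>i. A i) = {}" for A
  proof -
    have Ab: "A i \<in> sets borel" for i using A Q_borel by auto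
    have "\<exists>N. m (A N) < e" if "e > 0" for e
    proof -
      have "\<forall>i. \<exists>K. K \<subseteq> A i \<and> compact K \<and> m (A i - K) < e * (1/2) ^ (Suc i)"
        using A(1) \<open>e > 0\<close> by (intro allI inner_Q) auto
      then obtain k where k: "\<And>i. k i \<subseteq> A i" "\<And>i. compact (k i)" "\<And>i. m (A i - k i) < e * (1/2) ^ (Suc i)"
        by metis
      have "\<Inter>(range k) \<subseteq> \<Inter>(range A)" using k(1) by (intro INF_mono) auto
      then have "k 0 \<inter> \<Inter>(k ` UNIV) = {}" using A(3) by simp
      then obtain I where I: "finite I" "k 0 \<inter> \<Inter>(k ` I) = {}"
        using compact_imp_fip_image[OF k(2)[of 0], of UNIV k] k(2) compact_imp_closed by metis
      \<comment> \<open>Index 0 is included because \<open>k 0\<close> takes part in the empty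
        intersection; it also covers the case of an empty \<open>I\<close>.\<close>
      define N where "N = Max (insert 0 I)"
      have IN: "i \<le> N" if "i \<in> I" for i using I that unfolding N_def by simp
      have "A N \<subseteq> (\<Union>i\<in>{..N}. A i - k i)"
      proof
        fix x assume x: "x \<in> A N"
        obtain i where "i \<le> N" "x \<notin> k i" using I IN by blast
        then show "x \<in> (\<Union>i\<in>{..N}. A i - k i)" using x decseqD[OF A(2)] by blast
      qed
      moreover have kb: "A i - k i \<in> sets borel" for i
        using k Ab by (simp add: sets.Diff compact_imp_closed)
      ultimately have "m (A N) \<le> m (\<Union>i\<in>{..N}. A i - k i)"
        by (intro mono Ab) auto
      also have "\<dots> \<le> (\<Sum>i\<in>{..N}. m (A i - k i))" using kb by (intro subadd_fin) auto
      also have "\<dots> \<le> (\<Sum>i\<in>{..N}. e * (1/2) ^ (Suc i))" by (intro sum_mono less_imp_le k)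
      also have "\<dots> = e * (1 - (1/2) ^ (Suc N))"
        by (induction N) (auto simp: field_simps)
      also have "\<dots> < e" using \<open>e > 0\<close> by simp
      finally show ?thesis by blast
    qed
    then have "(\<lambda>i. m (A i)) \<longlonglongrightarrow> 0"
      unfolding LIMSEQ_iff using nonneg[OF Ab] mono[OF decseqD[OF A(2)] Ab Ab]
      by (metis abs_of_nonneg diff_zero le_less_trans real_norm_def)
    then show ?thesis using tendsto_ennrealI by fastforce
  qed
  have "\<exists>p. (\<forall>s\<in>Q. p s = ennreal (m s)) \<and> measure_space UNIV (sigma_sets UNIV Q) p"
  proof (rule Q.caratheodory_empty_continuous)
    show "positive Q (\<lambda>A. ennreal (m A))" by (simp add: positive_def m0)
    show "additive Q (\<lambda>A. ennreal (m A))"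
      by (auto simp: additive_def add Q_borel nonneg)
  qed (use fin in auto)
  then obtain p where p: "\<And>s. s \<in> Q \<Longrightarrow> p s = ennreal (m s)" "measure_space UNIV (sigma_sets UNIV Q) p"
    by auto
  have sig: "sigma_sets UNIV Q = sets (borel :: ('a \<times> 'b) measure)"
    unfolding Q_def R.sigma_sets_generated_ring_eq by (simp add: sets_pair_measure flip: borel_prod)
  define \<pi> where "\<pi> = measure_of (UNIV :: ('a \<times> 'b) set) (sets borel) p"
  have [simp, measurable_cong]: "sets \<pi> = sets borel"
    unfolding \<pi>_def by (metis sets_measure_of sets.sigma_sets_eq space_borel subset_UNIV Pow_UNIV)
  have em: "emeasure \<pi> A = p A" if "A \<in> sets borel" for A
  proof -
    have "measure_space UNIV (sets (borel :: ('a \<times> 'b) measure)) p" using p(2) sig by simp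
    then show ?thesis unfolding \<pi>_def using that
      by (intro emeasure_measure_of_sigma) (auto simp: measure_space_def)
  qed
  have emQ: "emeasure \<pi> A = ennreal (m A)" if "A \<in> Q" for A
    using em[OF Q_borel[OF that]] p(1)[OF that] by simp
  have RQ: "E \<times> F \<in> Q" if "E \<in> sets borel" "F \<in> sets borel" for E F
    unfolding Q_def using that by (intro R.generated_ringI_Basic) auto
  have [simp]: "space \<pi> = UNIV" by (metis \<open>sets \<pi> = sets borel\<close> sets_eq_imp_space_eq space_borel)
  have [measurable]: "fst \<in> measurable \<pi> borel" "snd \<in> measurable \<pi> borel"
    by (auto simp: measurable_cong_sets[OF \<open>sets \<pi> = sets borel\<close> refl] intro!: borel_measurable_continuous_onI continuous_intros)
  have d1: "distr \<pi> borel fst = \<mu>"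
  proof (rule measure_eqI)
    fix E assume "E \<in> sets (distr \<pi> borel fst)"
    then have [measurable]: "E \<in> sets borel" by simp
    have "emeasure (distr \<pi> borel fst) E = emeasure \<pi> (E \<times> UNIV)"
      by (subst emeasure_distr) (auto intro!: arg_cong[of _ _ "emeasure \<pi>"])
    then show "emeasure (distr \<pi> borel fst) E = emeasure \<mu> E"
      by (simp add: emQ RQ m1 \<mu>.emeasure_eq_measure)
  qed (simp add: \<mu>)
  have d2: "distr \<pi> borel snd = \<nu>"
  proof (rule measure_eqI)
    fix E assume "E \<in> sets (distr \<pi> borel snd)"
    then have [measurable]: "E \<in> sets borel" by simp
    have "emeasure (distr \<pi> borel snd) E = emeasure \<pi> (UNIV \<times> E)"
      by (subst emeasure_distr) (auto intro!: arg_cong[of _ _ "emeasure \<pi>"])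
    then show "emeasure (distr \<pi> borel snd) E = emeasure \<nu> E"
      by (simp add: emQ RQ m2 \<nu>.emeasure_eq_measure)
  qed (simp add: \<nu>)
  have pr: "prob_space \<pi>"
    by (rule prob_spaceI) (use emQ[OF RQ[of UNIV UNIV]] m1[of UNIV] \<mu>.prob_space in
      \<open>simp add: \<mu> sets_eq_imp_space_eq[OF \<mu>(2)]\<close>)
  interpret \<pi>: prob_space \<pi> by fact
  have op: "measure \<pi> U \<le> m U" if "open U" for U
  proof -
    obtain \<A> :: "'a set set" where \<A>: "countable \<A>" "topological_basis \<A>" using ex_countable_basis by blast
    obtain \<B> :: "'b set set" where \<B>: "countable \<B>" "topological_basis \<B>" using ex_countable_basis by blast
    let ?D = "(\<lambda>(a, b). a \<times> b) ` (\<A> \<times> \<B>)"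
    have D: "topological_basis ?D" using topological_basis_prod \<A> \<B> by blast
    have "?D \<subseteq> Q" using topological_basis_open[OF \<A>(2)] topological_basis_open[OF \<B>(2)] by (auto intro!: RQ)
    moreover obtain D' where D': "D' \<subseteq> ?D" "U = \<Union>D'"
      using D \<open>open U\<close> unfolding topological_basis_def by metis
    \<comment> \<open>The empty set is added so that the family is the range of a sequence even when
      \<open>U\<close> is empty.\<close>
    ultimately have "insert {} D' \<subseteq> Q" by blast
    moreover have "countable D'" by (rule countable_subset[OF D'(1)]) (simp add: \<A> \<B>)
    then have "countable (insert {} D')" by simp
    ultimately obtain f :: "nat \<Rightarrow> ('a \<times> 'b) set" where f: "range f = insert {} D'"
      by (metis insert_not_empty uncountable_def)
    then have fQ: "f i \<in> Q" for i using \<open>insert {} D' \<subseteq> Q\<close> rangeI[of f i] by (metis subsetD)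
    define V where "V n = (\<Union>i\<in>{..n}. f i)" for n
    have VQ: "V n \<in> Q" for n unfolding V_def using fQ by (intro Q.finite_UN) auto
    have "(\<Union>n. V n) = \<Union>(range f)"
      unfolding V_def by (blast intro: atMost_iff[THEN iffD2, OF order_refl])
    then have VU: "(\<Union>n. V n) = U" using D' f by simp
    have "incseq V" unfolding incseq_def V_def by (intro allI impI UN_mono) auto
    have "(\<lambda>n. measure \<pi> (V n)) \<longlonglongrightarrow> measure \<pi> (\<Union>n. V n)"
      using VQ \<open>incseq V\<close> by (intro \<pi>.finite_Lim_measure_incseq) (auto simp: Q_borel)
    moreover have "measure \<pi> (V n) \<le> m U" for n
      using mono[of "V n" U] Q_borel[OF VQ] VU \<open>open U\<close> emQ[OF VQ] nonneg[OF Q_borel[OF VQ]]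
      by (auto simp: measure_def)
    ultimately show ?thesis unfolding VU by (auto intro: LIMSEQ_le_const2)
  qed
  show thesis using that pr d1 d2 op by simp
qed

section \<open>Lower semicontinuity of integrals under setwise limits\<close>

text \<open>Staircases turn values on open sets into lower bounds for integrals of continuous functions.\<close>

lemma staircase_le:
  fixes t :: real
  assumes "0 \<le> t" "0 < n"
  shows "(\<Sum>j\<in>{1..n\<^sup>2}. 1 / n * indicator {real j / n<..} t) \<le> t"
proof -
  have "(\<Sum>j\<in>{1..n\<^sup>2}. 1 / n * indicator {real j / n<..} t) \<le>
      (\<Sum>j\<in>{1..n\<^sup>2}. 1 / n * indicator {1..nat \<lfloor>n * t\<rfloor>} j :: real)"
    using assms by (intro sum_mono) (auto simp: indicator_def field_simps le_nat_iff le_floor_iff)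
  also have "\<dots> = (\<Sum>j\<in>{1..n\<^sup>2} \<inter> {1..nat \<lfloor>n * t\<rfloor>}. 1 / n)"
    unfolding sum.inter_restrict[OF finite_atLeastAtMost] by (intro sum.cong refl) (auto simp: indicator_def)
  also have "\<dots> \<le> (\<Sum>j\<in>{1..nat \<lfloor>n * t\<rfloor>}. 1 / n)"
    by (intro sum_mono2) auto
  also have "\<dots> = of_int \<lfloor>n * t\<rfloor> / n" using assms by simp
  also have "\<dots> \<le> t" using assms by (simp add: field_simps)
  finally show ?thesis .
qed

text \<open>The \<open>n\<^sup>2\<close> levels of spacing \<open>1 / n\<close> reach height
  \<open>n\<close>, and up to that height the staircase loses at most one step.\<close>

lemma staircase_ge:
  fixes t :: real
  assumes "0 \<le> t" "0 < n" "t \<le> n"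
  shows "t - 1 / n \<le> (\<Sum>j\<in>{1..n\<^sup>2}. 1 / n * indicator {real j / n<..} t)"
proof -
  \<comment> \<open>\<open>N\<close> is the ceiling of \<open>t * n\<close>, so the levels that lie
    strictly below \<open>t\<close> are those with \<open>1 \<le> j < N\<close>. There are
    \<open>N - 1\<close> of them, since a level equal to \<open>t\<close> does not count.\<close>
  define N where "N = nat \<lceil>t * n\<rceil>"
  have "t * real n \<le> real n * real n" using assms by (intro mult_right_mono) auto
  then have N: "N \<le> n\<^sup>2"
    by (simp add: N_def power2_eq_square nat_le_iff ceiling_le_iff)
  have "t * n - 1 \<le> real (N - 1)" unfolding N_def by linarith
  then have "(t * n - 1) * (1 / n) \<le> real (N - 1) * (1 / n)" by (intro mult_right_mono) auto
  moreover have "t - 1 / n = (t * n - 1) * (1 / n)" using assms by (simp add: field_simps)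
  ultimately have "t - 1 / n \<le> real (N - 1) * (1 / n)" by simp
  also have "\<dots> = (\<Sum>j\<in>{1..<N}. 1 / n)" by simp
  also have "\<dots> = (\<Sum>j\<in>{1..<N}. 1 / n * indicator {real j / n<..} t)"
  proof (intro sum.cong refl)
    fix j assume "j \<in> {1..<N}"
    then have "real j < t * n" by (auto simp: N_def less_ceiling_iff zless_nat_eq_int_zless)
    then show "1 / n = 1 / n * indicator {real j / n<..} t" using assms by (simp add: field_simps)
  qed
  also have "\<dots> \<le> (\<Sum>j\<in>{1..n\<^sup>2}. 1 / n * indicator {real j / n<..} t)"
    using N by (intro sum_mono2) auto
  finally show ?thesis .
qed

text \<open>This is one direction of the portmanteau theorem, with a set function \<open>m\<close>
  between the sequence and \<open>\<pi>\<close>. A staircase of \<open>c\<close> is a finite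
  positive combination of indicators of open superlevel sets, so its integral can be compared
  through \<open>conv\<close> and \<open>le\<close>; Fatou then removes the discretisation.\<close>

lemma nn_integral_le_setwise_limit:
  fixes c :: "'a::topological_space \<Rightarrow> real"
  assumes G: "G \<noteq> bot" and P: "\<And>n. prob_space (P n)" "\<And>n. sets (P n) = sets borel"
    and \<pi>: "prob_space \<pi>" "sets \<pi> = sets borel"
    and c: "continuous_on UNIV c" "\<And>x. 0 \<le> c x"
    and conv: "\<And>U. open U \<Longrightarrow> ((\<lambda>n. measure (P n) U) \<longlongrightarrow> m U) G"
    and le: "\<And>U. open U \<Longrightarrow> measure \<pi> U \<le> m U"
    and lim: "((\<lambda>n. \<integral>\<^sup>+x. ennreal (c x) \<partial>P n) \<longlongrightarrow> L) G"
  shows "(\<integral>\<^sup>+x. ennreal (c x) \<partial>\<pi>) \<le> L"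
proof -
  \<comment> \<open>\<open>Suc k\<close> is both the height and the inverse mesh, so that the
    staircases grow and refine together. The strict inequality at each level keeps the sets
    \<open>U k j\<close> open.\<close>
  define s where "s k x = (\<Sum>j\<in>{1..(Suc k)\<^sup>2}. 1 / Suc k * indicator {real j / Suc k<..} (c x))" for k x
  define U where "U k j = {x. real j / Suc k < c x}" for k j
  have op: "open (U k j)" for k j
    unfolding U_def using c by (intro open_Collect_less continuous_intros)
  have s_int: "(\<integral>\<^sup>+x. ennreal (s k x) \<partial>Q) = ennreal (\<Sum>j\<in>{1..(Suc k)\<^sup>2}. 1 / Suc k * measure Q (U k j))"
    if Q: "prob_space Q" "sets Q = sets borel" for k and Q :: "'a measure"
  proof -
    interpret Q: prob_space Q by fact
    have [measurable]: "U k j \<in> sets Q" for j using op Q by auto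
    have "ennreal (s k x) = (\<Sum>j\<in>{1..(Suc k)\<^sup>2}. ennreal (1 / Suc k) * indicator (U k j) x)" for x
    proof -
      have "s k x = (\<Sum>j\<in>{1..(Suc k)\<^sup>2}. 1 / Suc k * indicator (U k j) x)"
        unfolding s_def U_def by (intro sum.cong refl) (auto simp: indicator_def)
      also have "ennreal \<dots> = (\<Sum>j\<in>{1..(Suc k)\<^sup>2}. ennreal (1 / Suc k * indicator (U k j) x))"
        by (rule sum_ennreal[symmetric]) auto
      also have "\<dots> = (\<Sum>j\<in>{1..(Suc k)\<^sup>2}. ennreal (1 / Suc k) * indicator (U k j) x)"
        by (intro sum.cong refl) (auto split: split_indicator)
      finally show ?thesis .
    qed
    then have "(\<integral>\<^sup>+x. ennreal (s k x) \<partial>Q) = (\<integral>\<^sup>+x. (\<Sum>j\<in>{1..(Suc k)\<^sup>2}. ennreal (1 / Suc k) * indicator (U k j) x) \<partial>Q)"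
      by presburger
    also have "\<dots> = (\<Sum>j\<in>{1..(Suc k)\<^sup>2}. ennreal (1 / Suc k) * emeasure Q (U k j))"
      by (subst nn_integral_sum) (auto simp: nn_integral_cmult_indicator)
    also have "\<dots> = (\<Sum>j\<in>{1..(Suc k)\<^sup>2}. ennreal (1 / Suc k * measure Q (U k j)))"
      unfolding Q.emeasure_eq_measure by (intro sum.cong refl ennreal_mult'[symmetric]) auto
    also have "\<dots> = ennreal (\<Sum>j\<in>{1..(Suc k)\<^sup>2}. 1 / Suc k * measure Q (U k j))"
      by (rule sum_ennreal) auto
    finally show ?thesis .
  qed
  have up: "s k x \<le> c x" for k x
    unfolding s_def by (rule staircase_le) (auto simp: c)
  have lo: "eventually (\<lambda>k. c x - 1 / Suc k \<le> s k x) sequentially" for x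
  proof -
    obtain N :: nat where "c x \<le> N" using real_arch_simple by blast
    then have "c x - 1 / Suc k \<le> s k x" if "k \<ge> N" for k
      unfolding s_def using that by (intro staircase_ge) (auto simp: c)
    then show ?thesis by (auto simp: eventually_sequentially)
  qed
  have s_lim: "(\<lambda>k. s k x) \<longlonglongrightarrow> c x" for x
  proof (rule tendsto_sandwich[OF lo])
    have "(\<lambda>k. c x - 1 / Suc k) \<longlonglongrightarrow> c x - 0"
      by (intro tendsto_intros) (rule LIMSEQ_Suc[OF lim_1_over_n])
    then show "(\<lambda>k. c x - 1 / Suc k) \<longlonglongrightarrow> c x" by simp
  qed (auto simp: up)
  have s_le: "(\<integral>\<^sup>+x. ennreal (s k x) \<partial>\<pi>) \<le> L" for k
  proof -
    have "((\<lambda>n. ennreal (\<Sum>j\<in>{1..(Suc k)\<^sup>2}. 1 / Suc k * measure (P n) (U k j))) \<longlongrightarrow>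
        ennreal (\<Sum>j\<in>{1..(Suc k)\<^sup>2}. 1 / Suc k * m (U k j))) G"
      by (intro tendsto_ennrealI tendsto_intros conv op)
    moreover have "ennreal (\<Sum>j\<in>{1..(Suc k)\<^sup>2}. 1 / Suc k * measure (P n) (U k j)) \<le> (\<integral>\<^sup>+x. ennreal (c x) \<partial>P n)" for n
      unfolding s_int[OF P, symmetric] by (intro nn_integral_mono ennreal_leI up)
    ultimately have "ennreal (\<Sum>j\<in>{1..(Suc k)\<^sup>2}. 1 / Suc k * m (U k j)) \<le> L"
      using lim G by (intro tendsto_le[of G]) auto
    moreover have "(\<integral>\<^sup>+x. ennreal (s k x) \<partial>\<pi>) \<le> ennreal (\<Sum>j\<in>{1..(Suc k)\<^sup>2}. 1 / Suc k * m (U k j))"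
      unfolding s_int[OF \<pi>] by (intro ennreal_leI sum_mono mult_left_mono le op) auto
    ultimately show ?thesis by order
  qed
  have [measurable]: "c \<in> borel_measurable \<pi>"
    unfolding measurable_cong_sets[OF \<pi>(2) refl] by (rule borel_measurable_continuous_onI[OF c(1)])
  have [measurable]: "s k \<in> borel_measurable \<pi>" for k
    unfolding s_def by measurable
  have "(\<integral>\<^sup>+x. ennreal (c x) \<partial>\<pi>) = (\<integral>\<^sup>+x. liminf (\<lambda>k. ennreal (s k x)) \<partial>\<pi>)"
    by (intro nn_integral_cong lim_imp_Liminf[symmetric] tendsto_ennrealI s_lim) auto
  also have "\<dots> \<le> liminf (\<lambda>k. \<integral>\<^sup>+x. ennreal (s k x) \<partial>\<pi>)"
    by (rule nn_integral_liminf) measurable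
  also have "\<dots> \<le> liminf (\<lambda>k. L)" by (intro Liminf_mono) (auto simp: s_le)
  also have "\<dots> = L" by (simp add: Liminf_const)
  finally show ?thesis .
qed

section \<open>Couplings and the direct method\<close>

lemma measurable_borel_sets:
  assumes "sets M = sets borel" "f \<in> measurable borel N"
  shows "f \<in> measurable M N"
  using assms(2) by (simp add: measurable_cong_sets[OF assms(1) refl])

lemma coupling_marginals:
  assumes "\<pi> \<in> couplings \<mu> \<nu>"
  shows "E \<in> sets borel \<Longrightarrow> emeasure \<pi> (E \<times> UNIV) = emeasure \<mu> E"
    and "E \<in> sets borel \<Longrightarrow> emeasure \<pi> (UNIV \<times> E) = emeasure \<nu> E"
proof -
  have \<pi>: "sets \<pi> = sets borel" "\<mu> = distr \<pi> borel fst" "\<nu> = distr \<pi> borel snd"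
    using assms by (auto simp: couplings_def)
  have [measurable]: "fst \<in> measurable \<pi> borel" "snd \<in> measurable \<pi> borel"
    by (auto intro!: measurable_borel_sets[OF \<pi>(1)] borel_measurable_continuous_onI continuous_intros)
  have sp: "space \<pi> = UNIV" using sets_eq_imp_space_eq[OF \<pi>(1)] by simp
  show "emeasure \<pi> (E \<times> UNIV) = emeasure \<mu> E" if "E \<in> sets borel"
    unfolding \<pi>(2) using that by (subst emeasure_distr) (auto simp: sp intro!: arg_cong[of _ _ "emeasure \<pi>"])
  show "emeasure \<pi> (UNIV \<times> E) = emeasure \<nu> E" if "E \<in> sets borel"
    unfolding \<pi>(3) using that by (subst emeasure_distr) (auto simp: sp intro!: arg_cong[of _ _ "emeasure \<pi>"])
qed

text \<open>The independent coupling ensures that the infimum of the cost is taken over a nonempty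
  set and so has a minimising sequence.\<close>

lemma pair_measure_in_couplings:
  assumes \<mu>: "prob_space \<mu>" "sets \<mu> = sets borel" and \<nu>: "prob_space \<nu>" "sets \<nu> = sets borel"
  shows "\<mu> \<Otimes>\<^sub>M \<nu> \<in> couplings \<mu> \<nu>"
proof -
  interpret \<mu>: prob_space \<mu> by fact
  interpret \<nu>: prob_space \<nu> by fact
  interpret pair_prob_space \<mu> \<nu> ..
  have "prob_space (\<mu> \<Otimes>\<^sub>M \<nu>)" using \<mu>(1) \<nu>(1) by (rule prob_space_pair)
  moreover have s: "sets (\<mu> \<Otimes>\<^sub>M \<nu>) = sets borel"
    unfolding borel_prod[symmetric] using \<mu> \<nu> by (intro sets_pair_measure_cong)
  moreover have sp: "space \<mu> = UNIV" "space \<nu> = UNIV"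
    using \<mu> \<nu> by (auto dest: sets_eq_imp_space_eq)
  moreover have "distr (\<mu> \<Otimes>\<^sub>M \<nu>) borel fst = \<mu>"
  proof -
    have "distr (\<mu> \<Otimes>\<^sub>M \<nu>) borel fst = distr (\<mu> \<Otimes>\<^sub>M \<nu>) \<mu> fst" using \<mu> by (intro distr_cong) auto
    then show ?thesis using \<nu>.distr_pair_fst[of \<mu>] \<mu>.sigma_finite_measure_axioms by (simp add: \<nu>.emeasure_space_1)
  qed
  moreover have "distr (\<mu> \<Otimes>\<^sub>M \<nu>) borel snd = \<nu>"
  proof (rule measure_eqI)
    fix E assume "E \<in> sets (distr (\<mu> \<Otimes>\<^sub>M \<nu>) borel snd)"
    then have [measurable]: "E \<in> sets \<nu>" using \<nu> by simp
    have "snd \<in> measurable (\<mu> \<Otimes>\<^sub>M \<nu>) borel"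
      by (intro measurable_borel_sets[OF s] borel_measurable_continuous_onI continuous_intros)
    moreover have "snd -` E \<inter> space (\<mu> \<Otimes>\<^sub>M \<nu>) = space \<mu> \<times> E"
      by (auto simp: sp space_pair_measure)
    moreover have "E \<in> sets borel" using \<open>E \<in> sets \<nu>\<close> \<nu> by simp
    ultimately have "emeasure (distr (\<mu> \<Otimes>\<^sub>M \<nu>) borel snd) E = emeasure (\<mu> \<Otimes>\<^sub>M \<nu>) (space \<mu> \<times> E)"
      by (simp add: emeasure_distr)
    then show "emeasure (distr (\<mu> \<Otimes>\<^sub>M \<nu>) borel snd) E = emeasure \<nu> E"
      by (simp add: \<nu>.emeasure_pair_measure_Times \<mu>.emeasure_space_1)
  qed (simp add: \<nu>)
  ultimately show ?thesis by (simp add: couplings_def)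
qed

text \<open>Direct method: a minimising sequence clusters setwise, the cluster point is replaced by
  a genuine coupling, and the cost of that coupling is at most the limit of the costs. The
  comparison takes place in \<open>ennreal\<close>, so an infinite infimum is covered too.\<close>

lemma optimal_coupling_exists:
  assumes \<mu>: "prob_space \<mu>" "sets \<mu> = sets borel" and \<nu>: "prob_space \<nu>" "sets \<nu> = sets borel"
  shows "\<exists>\<pi>. \<pi> \<in> optimal_couplings \<mu> \<nu>"
proof -
  let ?C = "couplings \<mu> \<nu>"
  have "transport_cost ` ?C \<noteq> {}" using pair_measure_in_couplings[OF assms] by blast
  then obtain f where f: "decseq f" "range f \<subseteq> transport_cost ` ?C" "Inf (transport_cost ` ?C) = (INF n. f n)"
    by (metis ennreal_Inf_countable_INF)
  have "\<forall>n. \<exists>\<pi>. \<pi> \<in> ?C \<and> f n = transport_cost \<pi>" using f(2) by blast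
  then obtain P where P: "\<And>n. P n \<in> ?C" "\<And>n. f n = transport_cost (P n)" by metis
  have PP: "prob_space (P n)" "sets (P n) = sets borel" for n using P(1)[of n] by (auto simp: couplings_def)
  obtain G m where G: "G \<noteq> bot" "G \<le> sequentially" and m: "\<And>B. ((\<lambda>n. measure (P n) B) \<longlongrightarrow> m B) G"
    using setwise_cluster[of P] PP by blast
  \<comment> \<open>The marginals are constant along the sequence, so \<open>m\<close> has the same
    ones.\<close>
  have const: "m B = a" if "\<And>n. measure (P n) B = a" for B a
    using tendsto_unique[OF G(1) m, of B a] that by simp
  obtain \<pi> where \<pi>: "prob_space \<pi>" "sets \<pi> = sets borel" "distr \<pi> borel fst = \<mu>" "distr \<pi> borel snd = \<nu>"
    "\<And>U. open U \<Longrightarrow> measure \<pi> U \<le> m U"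
  proof (rule coupling_extension[OF assms, of m])
    show "0 \<le> m A" for A
      using tendsto_lowerbound[OF m _ G(1), of 0 A] by simp
    show "m (A \<union> B) = m A + m B" if "A \<in> sets borel" "B \<in> sets borel" "A \<inter> B = {}" for A B
    proof (rule tendsto_unique[OF G(1) m])
      have "measure (P n) (A \<union> B) = measure (P n) A + measure (P n) B" for n
        using that PP[of n] by (intro finite_measure.finite_measure_Union prob_space.finite_measure) auto
      then show "((\<lambda>n. measure (P n) (A \<union> B)) \<longlongrightarrow> m A + m B) G"
        using tendsto_add[OF m[of A] m[of B]] by simp
    qed
    show "m (E \<times> UNIV) = measure \<mu> E" if "E \<in> sets borel" for E
      by (rule const) (simp add: measure_def coupling_marginals[OF P(1)] that)
    show "m (UNIV \<times> F) = measure \<nu> F" if "F \<in> sets borel" for F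
      by (rule const) (simp add: measure_def coupling_marginals[OF P(1)] that)
  qed blast
  then have C: "\<pi> \<in> ?C" by (simp add: couplings_def)
  have "f \<longlonglongrightarrow> (INF n. f n)" using f(1) by (rule LIMSEQ_INF)
  then have lim: "((\<lambda>n. transport_cost (P n)) \<longlongrightarrow> (INF \<pi>\<in>?C. transport_cost \<pi>)) G"
    using filterlim_mono[OF _ order_refl G(2)] unfolding f(3) P(2) by blast
  have "transport_cost \<pi> \<le> (INF \<pi>\<in>?C. transport_cost \<pi>)"
    unfolding transport_cost_def case_prod_beta
  proof (rule nn_integral_le_setwise_limit[OF G(1) PP \<pi>(1,2) _ _ m \<pi>(5)])
    show "continuous_on UNIV (\<lambda>z . (norm (fst z - snd z))\<^sup>2)"
      by (intro continuous_intros)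
    show "((\<lambda>n. \<integral>\<^sup>+z. ennreal ((norm (fst z - snd z))\<^sup>2) \<partial>P n) \<longlongrightarrow>
        (INF \<pi>\<in>?C. \<integral>\<^sup>+z. ennreal ((norm (fst z - snd z))\<^sup>2) \<partial>\<pi>)) G"
      using lim unfolding transport_cost_def case_prod_beta .
  qed auto
  moreover have "(INF \<pi>\<in>?C. transport_cost \<pi>) \<le> transport_cost \<pi>" using C by (rule INF_lower)
  ultimately show ?thesis using C by (auto simp: optimal_couplings_def)
qed

section \<open>Monotonicity of optimal couplings\<close>

lemma coupling_measurable:
  assumes "\<pi> \<in> couplings \<mu> \<nu>" "continuous_on UNIV f"
  shows "f \<in> borel_measurable \<pi>"
  using assms by (auto simp: couplings_def intro!: measurable_borel_sets borel_measurable_continuous_onI)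

lemma coupling_nn_integral:
  assumes "\<pi> \<in> couplings \<mu> \<nu>" "f \<in> borel_measurable borel"
  shows "(\<integral>\<^sup>+z. f (fst z) \<partial>\<pi>) = (\<integral>\<^sup>+x. f x \<partial>\<mu>)" "(\<integral>\<^sup>+z. f (snd z) \<partial>\<pi>) = (\<integral>\<^sup>+y. f y \<partial>\<nu>)"
proof -
  have \<pi>: "\<mu> = distr \<pi> borel fst" "\<nu> = distr \<pi> borel snd"
    using assms(1) by (auto simp: couplings_def)
  have [measurable]: "fst \<in> measurable \<pi> borel" "snd \<in> measurable \<pi> borel"
    by (auto intro!: coupling_measurable[OF assms(1)] continuous_intros)
  note assms(2)[measurable]
  show "(\<integral>\<^sup>+z. f (fst z) \<partial>\<pi>) = (\<integral>\<^sup>+x. f x \<partial>\<mu>)" unfolding \<pi>(1) by (subst nn_integral_distr) auto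
  show "(\<integral>\<^sup>+z. f (snd z) \<partial>\<pi>) = (\<integral>\<^sup>+y. f y \<partial>\<nu>)" unfolding \<pi>(2) by (subst nn_integral_distr) auto
qed

lemma coupling_integrable_norm:
  assumes \<pi>: "\<pi> \<in> couplings \<mu> \<nu>" and P2: "\<mu> \<in> P2" "\<nu> \<in> P2"
  shows "integrable \<pi> (\<lambda>z. (norm (fst z))\<^sup>2)" "integrable \<pi> (\<lambda>z. (norm (snd z))\<^sup>2)"
proof -
  have "(\<integral>\<^sup>+z. ennreal ((norm (fst z))\<^sup>2) \<partial>\<pi>) < \<infinity>" "(\<integral>\<^sup>+z. ennreal ((norm (snd z))\<^sup>2) \<partial>\<pi>) < \<infinity>"
    using P2 coupling_nn_integral[OF \<pi>, of "\<lambda>x. ennreal ((norm x)\<^sup>2)"] by (auto simp: P2_def)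
  then show "integrable \<pi> (\<lambda>z. (norm (fst z))\<^sup>2)" "integrable \<pi> (\<lambda>z. (norm (snd z))\<^sup>2)"
    by (auto intro!: integrableI_bounded coupling_measurable[OF \<pi>] continuous_intros)
qed

text \<open>A growth criterion that serves both the cost and the coefficients of its expansion
  around a matrix.\<close>

lemma coupling_integrable_quadratic:
  assumes \<pi>: "\<pi> \<in> couplings \<mu> \<nu>" and P2: "\<mu> \<in> P2" "\<nu> \<in> P2"
    and f: "continuous_on UNIV f" "\<And>z. \<bar>f z\<bar> \<le> C * ((norm (fst z))\<^sup>2 + (norm (snd z))\<^sup>2)"
  shows "integrable \<pi> (f :: _ \<Rightarrow> real)"
proof (rule Bochner_Integration.integrable_bound)
  show "integrable \<pi> (\<lambda>z. C * ((norm (fst z))\<^sup>2 + (norm (snd z))\<^sup>2))"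
    using coupling_integrable_norm[OF \<pi> P2] by auto
  show "f \<in> borel_measurable \<pi>" by (rule coupling_measurable[OF \<pi> f(1)])
  show "AE z in \<pi>. norm (f z) \<le> norm (C * ((norm (fst z))\<^sup>2 + (norm (snd z))\<^sup>2))"
    using f(2) by (auto intro!: AE_I2 order_trans[OF f(2)])
qed

lemma norm_diff_power2_le:
  fixes x y :: "'a::real_normed_vector"
  shows "(norm (x - y))\<^sup>2 \<le> 2 * ((norm x)\<^sup>2 + (norm y)\<^sup>2)"
proof -
  have "(norm (x - y))\<^sup>2 \<le> (norm x + norm y)\<^sup>2" by (intro power_mono norm_triangle_ineq4) auto
  also have "\<dots> \<le> 2 * ((norm x)\<^sup>2 + (norm y)\<^sup>2)"
    using sum_squares_ge_zero[of "norm x - norm y" 0] by (simp add: power2_eq_square algebra_simps)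
  finally show ?thesis .
qed

text \<open>Second moments make every coupling have finite cost, so costs become real integrals
  whose differences can be formed.\<close>

lemma transport_cost_coupling:
  assumes \<pi>: "\<pi> \<in> couplings \<mu> \<nu>" and P2: "\<mu> \<in> P2" "\<nu> \<in> P2"
  shows "integrable \<pi> (\<lambda>z. (norm (fst z - snd z))\<^sup>2)"
    and "transport_cost \<pi> = ennreal (\<integral>z. (norm (fst z - snd z))\<^sup>2 \<partial>\<pi>)"
proof -
  show i: "integrable \<pi> (\<lambda>z. (norm (fst z - snd z))\<^sup>2)"
  proof (rule coupling_integrable_quadratic[OF \<pi> P2])
    show "\<bar>(norm (fst z - snd z))\<^sup>2\<bar> \<le> 2 * ((norm (fst z))\<^sup>2 + (norm (snd z))\<^sup>2)" for z
      using norm_diff_power2_le[of "fst z" "snd z"] by simp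
  qed (intro continuous_intros)
  show "transport_cost \<pi> = ennreal (\<integral>z. (norm (fst z - snd z))\<^sup>2 \<partial>\<pi>)"
    unfolding transport_cost_def case_prod_beta using i by (intro nn_integral_eq_integral) auto
qed

text \<open>Exchanging y and y' changes |x - y|^2 + |x' - y'|^2 by 2 (x - x') . (y - y'). Exchanging
  exactly where this is negative produces a competitor, which would be strictly cheaper if that
  happened with positive probability.\<close>

lemma optimal_coupling_monotone_AE:
  fixes \<mu> \<nu> :: "(real^'d) measure"
  assumes opt: "\<pi> \<in> optimal_couplings \<mu> \<nu>" and P2: "\<mu> \<in> P2" "\<nu> \<in> P2"
  shows "AE w in \<pi> \<Otimes>\<^sub>M \<pi>. 0 \<le> (fst (fst w) - fst (snd w)) \<bullet> (snd (fst w) - snd (snd w))"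
proof -
  have \<pi>: "\<pi> \<in> couplings \<mu> \<nu>" using opt by (simp add: optimal_couplings_def)
  then have s\<pi>: "sets \<pi> = sets borel" and "prob_space \<pi>"
    and m\<pi>: "distr \<pi> borel fst = \<mu>" "distr \<pi> borel snd = \<nu>" by (auto simp: couplings_def)
  interpret \<pi>: prob_space \<pi> by fact
  interpret pair_prob_space \<pi> \<pi> ..
  define Q where "Q = \<pi> \<Otimes>\<^sub>M \<pi>"
  have sQ: "sets Q = sets borel"
    unfolding Q_def using sets_pair_measure_cong[OF s\<pi> s\<pi>] by (simp only: borel_prod)
  have "prob_space Q" unfolding Q_def by (rule prob_space_axioms)
  interpret Q: prob_space Q by fact
  have mQ: "f \<in> measurable Q N" if "f \<in> measurable borel N" for f :: "_ \<Rightarrow> 'z" and N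
    using measurable_borel_sets[OF sQ that] .
  have spQ: "space Q = UNIV" using sets_eq_imp_space_eq[OF sQ] by simp
  define \<sigma> :: "((real^'d) \<times> (real^'d)) \<times> ((real^'d) \<times> (real^'d)) \<Rightarrow> _" where "\<sigma> w = (snd w, fst w)" for w
  have dist_fst: "distr Q \<pi> fst = \<pi>"
    unfolding Q_def using \<pi>.distr_pair_fst[of \<pi>] by (simp add: \<pi>.emeasure_space_1)
  have dist_swap: "distr Q Q \<sigma> = Q"
    unfolding Q_def \<sigma>_def using distr_pair_swap[symmetric] unfolding case_prod_beta' .
  have m\<sigma>: "\<sigma> \<in> measurable Q Q" unfolding Q_def \<sigma>_def by measurable
  define D where "D w = (fst (fst w) - fst (snd w)) \<bullet> (snd (fst w) - snd (snd w))"
    for w :: "((real^'d) \<times> (real^'d)) \<times> ((real^'d) \<times> (real^'d))"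
  have contD: "continuous_on UNIV D" unfolding D_def by (intro continuous_intros)
  have [measurable]: "D \<in> borel_measurable borel" by (rule borel_measurable_continuous_onI[OF contD])
  \<comment> \<open>exchange the second components where this lowers the cost\<close>
  define h where "h w = (fst (fst w), if D w < 0 then snd (snd w) else snd (fst w))" for w
  have projs: "(\<lambda>w :: ((real^'d) \<times> (real^'d)) \<times> ((real^'d) \<times> (real^'d)). fst (fst w)) \<in> borel_measurable borel"
    "(\<lambda>w :: ((real^'d) \<times> (real^'d)) \<times> ((real^'d) \<times> (real^'d)). snd (fst w)) \<in> borel_measurable borel"
    "(\<lambda>w :: ((real^'d) \<times> (real^'d)) \<times> ((real^'d) \<times> (real^'d)). fst (snd w)) \<in> borel_measurable borel"
    "(\<lambda>w :: ((real^'d) \<times> (real^'d)) \<times> ((real^'d) \<times> (real^'d)). snd (snd w)) \<in> borel_measurable borel"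
    by (intro borel_measurable_continuous_onI continuous_intros)+
  note [measurable] = projs
  have mh: "h \<in> measurable borel borel"
    unfolding h_def borel_prod[symmetric, where 'a = "real^'d" and 'b = "real^'d"] by measurable
  have int_swap: "(\<integral>\<^sup>+w. f (\<sigma> w) \<partial>Q) = (\<integral>\<^sup>+w. f w \<partial>Q)" if "f \<in> borel_measurable borel" for f
  proof -
    have "(\<integral>\<^sup>+w. f w \<partial>Q) = (\<integral>\<^sup>+w. f w \<partial>(distr Q Q \<sigma>))" by (simp add: dist_swap)
    also have "\<dots> = (\<integral>\<^sup>+w. f (\<sigma> w) \<partial>Q)" by (rule nn_integral_distr[OF m\<sigma>]) (simp add: mQ that)
    finally show ?thesis by simp
  qed
  \<comment> \<open>The set on which values are exchanged is invariant under
    \<open>\<sigma>\<close>, and so is \<open>Q\<close>. Therefore y' on this set has the same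
    distribution as y, and the exchange preserves the second marginal.\<close>
  have D\<sigma>: "D (\<sigma> w) = D w" for w unfolding D_def \<sigma>_def by (simp add: algebra_simps)
  define \<pi>' where "\<pi>' = distr Q borel h"
  have int_fst: "(\<integral>\<^sup>+w. f (fst w) \<partial>Q) = (\<integral>\<^sup>+z. f z \<partial>\<pi>)" if "f \<in> borel_measurable borel" for f
  proof -
    have "(\<integral>\<^sup>+z. f z \<partial>\<pi>) = (\<integral>\<^sup>+z. f z \<partial>(distr Q \<pi> fst))" by (simp add: dist_fst)
    also have "\<dots> = (\<integral>\<^sup>+w. f (fst w) \<partial>Q)"
      using measurable_borel_sets[OF s\<pi> that] by (intro nn_integral_distr) (auto simp: Q_def)
    finally show ?thesis by simp
  qed
  have coupl: "\<pi>' \<in> couplings \<mu> \<nu>"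
  proof -
    have "prob_space \<pi>'" unfolding \<pi>'_def by (rule Q.prob_space_distr[OF mQ[OF mh]])
    moreover have "distr \<pi>' borel fst = \<mu>"
    proof -
      have "distr \<pi>' borel fst = distr Q borel (fst \<circ> h)"
        unfolding \<pi>'_def by (rule distr_distr[OF _ mQ[OF mh]]) (intro borel_measurable_continuous_onI continuous_intros)
      also have "fst \<circ> h = fst \<circ> fst" by (auto simp: h_def)
      also have "distr Q borel (fst \<circ> fst) = distr (distr Q \<pi> fst) borel fst"
        by (rule distr_distr[symmetric]) (auto simp: Q_def intro!: coupling_measurable[OF \<pi>] continuous_intros)
      finally show ?thesis by (simp add: dist_fst m\<pi>)
    qed
    moreover have "distr \<pi>' borel snd = \<nu>"
    proof (rule measure_eqI)
      fix B assume "B \<in> sets (distr \<pi>' borel snd)"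
      then have B[measurable]: "B \<in> sets borel" by simp
      have "emeasure (distr \<pi>' borel snd) B = (\<integral>\<^sup>+y. indicator B y \<partial>distr \<pi>' borel snd)" by simp
      also have "\<dots> = (\<integral>\<^sup>+z. indicator B (snd z) \<partial>\<pi>')"
        by (rule nn_integral_distr) (auto simp: \<pi>'_def intro!: borel_measurable_continuous_onI continuous_intros)
      also have "\<dots> = (\<integral>\<^sup>+w. indicator B (snd (h w)) \<partial>Q)"
        unfolding \<pi>'_def by (rule nn_integral_distr[OF mQ[OF mh]]) (simp flip: borel_prod)
      also have "\<dots> = (\<integral>\<^sup>+w. indicator {w. D w < 0} w * indicator B (snd (snd w)) +
          indicator {w. \<not> D w < 0} w * indicator B (snd (fst w)) \<partial>Q)"
        by (intro nn_integral_cong) (auto simp: h_def split: split_indicator)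
      also have "\<dots> = (\<integral>\<^sup>+w. indicator {w. D w < 0} w * indicator B (snd (snd w)) \<partial>Q) +
          (\<integral>\<^sup>+w. indicator {w. \<not> D w < 0} w * indicator B (snd (fst w)) \<partial>Q)"
        by (intro nn_integral_add mQ) measurable
      also have "(\<integral>\<^sup>+w. indicator {w. D w < 0} w * indicator B (snd (snd w)) \<partial>Q) =
          (\<integral>\<^sup>+w. indicator {w. D w < 0} (\<sigma> w) * indicator B (snd (fst (\<sigma> w))) \<partial>Q)"
        by (simp add: D\<sigma> indicator_def) (simp add: \<sigma>_def)
      also have "\<dots> = (\<integral>\<^sup>+w. indicator {w. D w < 0} w * indicator B (snd (fst w)) \<partial>Q)"
        by (rule int_swap[of "\<lambda>w. indicator {w. D w < 0} w * indicator B (snd (fst w))"]) measurable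
      also have "\<dots> + (\<integral>\<^sup>+w. indicator {w. \<not> D w < 0} w * indicator B (snd (fst w)) \<partial>Q) =
          (\<integral>\<^sup>+w. indicator {w. D w < 0} w * indicator B (snd (fst w)) +
            indicator {w. \<not> D w < 0} w * indicator B (snd (fst w)) \<partial>Q)"
        by (intro nn_integral_add[symmetric] mQ) measurable
      also have "\<dots> = (\<integral>\<^sup>+w. indicator B (snd (fst w)) \<partial>Q)"
        by (intro nn_integral_cong) (auto split: split_indicator)
      also have "\<dots> = (\<integral>\<^sup>+z. indicator B (snd z) \<partial>\<pi>)"
        by (rule int_fst[of "\<lambda>z. indicator B (snd z)"]) (simp flip: borel_prod)
      also have "\<dots> = (\<integral>\<^sup>+y. indicator B y \<partial>\<nu>)"
        by (rule coupling_nn_integral[OF \<pi>]) simp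
      also have "\<dots> = emeasure \<nu> B" using P2 by (simp add: P2_def)
      finally show "emeasure (distr \<pi>' borel snd) B = emeasure \<nu> B" .
    qed (use P2 in \<open>simp add: P2_def\<close>)
    ultimately show ?thesis by (simp add: couplings_def \<pi>'_def)
  qed
  let ?c = "\<lambda>z :: (real^'d) \<times> (real^'d). (norm (fst z - snd z))\<^sup>2"
  have cc: "continuous_on UNIV ?c" by (intro continuous_intros)
  have mc: "?c \<in> borel_measurable borel" by (intro borel_measurable_continuous_onI cc)
  have ip: "integrable Q (\<lambda>w. ?c (fst w))" "(\<integral>w. ?c (fst w) \<partial>Q) = (\<integral>z. ?c z \<partial>\<pi>)"
  proof -
    have f: "fst \<in> measurable Q \<pi>" by (simp add: Q_def)
    have c: "?c \<in> borel_measurable \<pi>" by (rule coupling_measurable[OF \<pi> cc])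
    show "integrable Q (\<lambda>w. ?c (fst w))"
      using transport_cost_coupling(1)[OF \<pi> P2] integrable_distr_eq[OF f c] by (simp add: dist_fst)
    show "(\<integral>w. ?c (fst w) \<partial>Q) = (\<integral>z. ?c z \<partial>\<pi>)"
      using integral_distr[OF f c] by (simp add: dist_fst)
  qed
  have ip': "integrable Q (\<lambda>w. ?c (h w))" "(\<integral>w. ?c (h w) \<partial>Q) = (\<integral>z. ?c z \<partial>\<pi>')"
  proof -
    show "integrable Q (\<lambda>w. ?c (h w))"
      using transport_cost_coupling(1)[OF coupl P2] integrable_distr_eq[OF mQ[OF mh] mc] by (simp add: \<pi>'_def)
    show "(\<integral>w. ?c (h w) \<partial>Q) = (\<integral>z. ?c z \<partial>\<pi>')"
      using integral_distr[OF mQ[OF mh] mc] by (simp add: \<pi>'_def)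
  qed
  have "transport_cost \<pi> \<le> transport_cost \<pi>'"
    using opt coupl by (auto simp: optimal_couplings_def intro: INF_lower)
  then have "(\<integral>z. ?c z \<partial>\<pi>) \<le> (\<integral>z. ?c z \<partial>\<pi>')"
    unfolding transport_cost_coupling(2)[OF \<pi> P2] transport_cost_coupling(2)[OF coupl P2]
    by (subst (asm) ennreal_le_iff) (auto intro: integral_nonneg_AE)
  \<comment> \<open>\<open>g\<close> is the change of cost of the first pair, with nonnegative
    integral by optimality. It has no definite sign by itself, but adding its mirror image gives the
    change for both pairs, \<open>2 * min 0 (D w)\<close>, while the symmetry of \<open>Q\<close>
    just doubles the integral.\<close>
  define g where "g w = ?c (h w) - ?c (fst w)" for w
  have ig: "integrable Q g" unfolding g_def using ip(1) ip'(1) by (rule Bochner_Integration.integrable_diff[rotated])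
  have g0: "0 \<le> (\<integral>w. g w \<partial>Q)"
    using \<open>(\<integral>z. ?c z \<partial>\<pi>) \<le> (\<integral>z. ?c z \<partial>\<pi>')\<close> ip ip' unfolding g_def by simp
  have gm: "g \<in> borel_measurable Q" using ig by simp
  have ig': "integrable Q (\<lambda>w. g (\<sigma> w))" "(\<integral>w. g (\<sigma> w) \<partial>Q) = (\<integral>w. g w \<partial>Q)"
    using integrable_distr_eq[OF m\<sigma> gm] integral_distr[OF m\<sigma> gm] ig by (simp_all add: dist_swap)
  have gg: "g w + g (\<sigma> w) = 2 * min 0 (D w)" for w
    unfolding g_def h_def D\<sigma> by (auto simp: \<sigma>_def D_def power2_norm_eq_inner inner_diff algebra_simps inner_commute)
  have imin: "integrable Q (\<lambda>w. - min 0 (D w))"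
  proof -
    have "integrable Q (\<lambda>w. - (g w + g (\<sigma> w)) / 2)" using ig ig' by auto
    then show ?thesis by (simp add: gg)
  qed
  have "2 * (\<integral>w. - min 0 (D w) \<partial>Q) = - (\<integral>w. g w + g (\<sigma> w) \<partial>Q)"
    unfolding gg using imin by simp
  also have "\<dots> \<le> 0" using ig ig' g0 by simp
  finally have "(\<integral>w. - min 0 (D w) \<partial>Q) \<le> 0" by simp
  moreover have "0 \<le> (\<integral>w. - min 0 (D w) \<partial>Q)" by (intro integral_nonneg_AE) auto
  ultimately have "AE w in Q. - min 0 (D w) = 0"
    using integral_nonneg_eq_0_iff_AE[OF imin] by auto
  then have "AE w in Q. 0 \<le> D w" by eventually_elim (simp add: min_def split: if_splits)
  then show ?thesis unfolding Q_def D_def .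
qed

section \<open>Supports of optimal couplings\<close>

definition measure_support :: "'a::topological_space measure \<Rightarrow> 'a set" where
  "measure_support M = {z. \<forall>U. open U \<and> z \<in> U \<longrightarrow> emeasure M U \<noteq> 0}"

lemma closed_measure_support: "closed (measure_support M)"
proof -
  have "- measure_support M = \<Union>{U. open U \<and> emeasure M U = 0}"
    unfolding measure_support_def by blast
  then show ?thesis unfolding closed_def by (simp add: open_Union)
qed

text \<open>A countable basis covers the complement of the support by countably many null
  sets.\<close>

lemma AE_measure_support:
  fixes M :: "'a::second_countable_topology measure"
  assumes "sets M = sets borel"
  shows "AE z in M. z \<in> measure_support M"
proof -
  obtain B :: "'a set set" where B: "countable B" "topological_basis B" using ex_countable_basis by blast
  define C where "C = {U \<in> B. emeasure M U = 0}"
  have "countable C" using B(1) by (simp add: C_def)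
  moreover have "U \<in> null_sets M" if "U \<in> C" for U
    using that topological_basis_open[OF B(2)] assms by (auto simp: C_def null_sets_def)
  ultimately have "\<Union>C \<in> null_sets M" using null_sets_UN'[of C "\<lambda>U. U" M] by simp
  moreover have "{z \<in> space M. z \<notin> measure_support M} \<subseteq> \<Union>C"
  proof
    fix z assume "z \<in> {z \<in> space M. z \<notin> measure_support M}"
    then obtain U where U: "open U" "z \<in> U" "emeasure M U = 0" by (auto simp: measure_support_def)
    then obtain V where V: "V \<in> B" "z \<in> V" "V \<subseteq> U" using topological_basisE[OF B(2)] by metis
    have "emeasure M V \<le> emeasure M U" using U V assms by (intro emeasure_mono) auto
    then show "z \<in> \<Union>C" using U V by (auto simp: C_def)
  qed
  ultimately show ?thesis by (intro AE_I') auto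
qed

text \<open>Violating monotonicity is an open condition, so a violating pair of support points has a
  product neighbourhood of violating pairs. Its mass is positive, against the almost sure
  statement.\<close>

lemma optimal_coupling_support_monotone:
  assumes opt: "\<pi> \<in> optimal_couplings \<mu> \<nu>" and P2: "\<mu> \<in> P2" "\<nu> \<in> P2"
    and z: "z \<in> measure_support \<pi>" "z' \<in> measure_support \<pi>"
  shows "0 \<le> (fst z - fst z') \<bullet> (snd z - snd z')"
proof (rule ccontr)
  have s\<pi>: "sets \<pi> = sets borel" and "prob_space \<pi>" using opt by (auto simp: optimal_couplings_def couplings_def)
  interpret \<pi>: prob_space \<pi> by fact
  let ?D = "\<lambda>w. (fst (fst w) - fst (snd w)) \<bullet> (snd (fst w) - snd (snd w))"
  assume "\<not> 0 \<le> (fst z - fst z') \<bullet> (snd z - snd z')"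
  then have zz: "(z, z') \<in> {w. ?D w < 0}" by simp
  have "open {w. ?D w < 0}" by (intro open_Collect_less continuous_intros)
  from this zz obtain U V where "open U" "open V" "(z, z') \<in> U \<times> V" and sub: "U \<times> V \<subseteq> {w. ?D w < 0}"
    by (rule open_prod_elim) blast
  then have UV: "open U" "open V" "z \<in> U" "z' \<in> V" by auto
  have "U \<in> sets \<pi>" "V \<in> sets \<pi>" using UV s\<pi> by auto
  then have "emeasure (\<pi> \<Otimes>\<^sub>M \<pi>) (U \<times> V) = emeasure \<pi> U * emeasure \<pi> V"
    by (rule \<pi>.emeasure_pair_measure_Times)
  moreover have "emeasure \<pi> U \<noteq> 0" "emeasure \<pi> V \<noteq> 0" using UV z by (auto simp: measure_support_def)
  moreover have "AE w in \<pi> \<Otimes>\<^sub>M \<pi>. w \<notin> U \<times> V"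
    using optimal_coupling_monotone_AE[OF opt P2] by eventually_elim (use sub in force)
  then have "emeasure (\<pi> \<Otimes>\<^sub>M \<pi>) (U \<times> V) = 0"
    using AE_iff_null_sets[of "U \<times> V" "\<pi> \<Otimes>\<^sub>M \<pi>"] \<open>U \<in> sets \<pi>\<close> \<open>V \<in> sets \<pi>\<close> by (auto simp: null_sets_def)
  ultimately show False by simp
qed

section \<open>Uniqueness of optimal couplings\<close>

text \<open>By translation invariance, averaging the measure of \<open>N - t *\<^sub>R e\<close>
  over t in [0, 1] returns the measure of \<open>N\<close>. After Fubini the inner integral runs
  along a line and vanishes. The averaging allows any direction \<open>e\<close> without a splitting
  of the space into coordinates.\<close>

lemma null_set_countable_lines:
  fixes N :: "'a::euclidean_space set"
  assumes N: "N \<in> sets borel" and lines: "\<And>x. countable {t. x + t *\<^sub>R e \<in> N}"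
  shows "N \<in> null_sets lborel"
proof -
  have [measurable]: "N \<in> sets borel" by fact
  let ?f = "\<lambda>(t, x). indicator {0..1} t * indicator N (x + t *\<^sub>R e) :: ennreal"
  have "(\<lambda>p. snd p + fst p *\<^sub>R e) \<in> borel_measurable (borel :: (real \<times> 'a) measure)"
    by (intro borel_measurable_continuous_onI continuous_intros)
  then have [measurable]: "(\<lambda>(t, x). x + t *\<^sub>R e) \<in> measurable (lborel \<Otimes>\<^sub>M lborel) (borel :: 'a measure)"
    by (simp add: case_prod_beta' lborel_prod)
  have f: "?f \<in> borel_measurable (lborel \<Otimes>\<^sub>M lborel)" by measurable
  have "emeasure lborel N = (\<integral>\<^sup>+t. indicator {0..1} t * emeasure lborel N \<partial>(lborel :: real measure))"
    by (subst nn_integral_multc) auto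
  also have "\<dots> = (\<integral>\<^sup>+t. \<integral>\<^sup>+x. ?f (t, x) \<partial>lborel \<partial>lborel)"
  proof (intro nn_integral_cong)
    fix t :: real
    have "emeasure lborel N = (\<integral>\<^sup>+x. indicator N x \<partial>distr lborel borel ((+) (t *\<^sub>R e)))"
      by (simp add: lborel_distr_plus)
    also have "\<dots> = (\<integral>\<^sup>+x. indicator N (x + t *\<^sub>R e) \<partial>lborel)"
      by (subst nn_integral_distr) (auto simp: add.commute)
    finally show "indicator {0..1} t * emeasure lborel N = (\<integral>\<^sup>+x. ?f (t, x) \<partial>lborel)"
      by (simp add: nn_integral_cmult)
  qed
  also have "\<dots> = (\<integral>\<^sup>+x. \<integral>\<^sup>+t. ?f (t, x) \<partial>lborel \<partial>lborel)"
    using lborel_pair.Fubini'[of "\<lambda>t x. ?f (t, x)"] f by simp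
  also have "\<dots> = (\<integral>\<^sup>+x. 0 \<partial>(lborel :: 'a measure))"
  proof (intro nn_integral_cong)
    fix x :: 'a
    have "AE t in lborel. t \<notin> {t. x + t *\<^sub>R e \<in> N}"
      using lines[of x] by (intro AE_not_in countable_imp_null_set_lborel)
    then have "(\<integral>\<^sup>+t. ?f (t, x) \<partial>lborel) = (\<integral>\<^sup>+t. 0 \<partial>(lborel :: real measure))"
      by (intro nn_integral_cong_AE) (auto elim!: eventually_mono)
    then show "(\<integral>\<^sup>+t. ?f (t, x) \<partial>lborel) = 0" by simp
  qed
  finally have "emeasure lborel N = 0" by simp
  then show ?thesis by (intro null_setsI) auto
qed

text \<open>Projections of Borel sets can fail to be Borel, but a closed set is a countable union of
  compact sets, whose projections are compact.\<close>

lemma fst_image_closed_borel: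
  fixes S :: "('a::euclidean_space \<times> 'b::euclidean_space) set"
  assumes "closed S"
  shows "fst ` S \<in> sets borel"
proof -
  have "fst ` S = (\<Union>n::nat. fst ` (S \<inter> cball 0 (real n)))"
  proof -
    have "S = (\<Union>n::nat. S \<inter> cball 0 (real n))" by (auto intro: real_arch_simple)
    then show ?thesis by blast
  qed
  moreover have "fst ` (S \<inter> cball 0 (real n)) \<in> sets borel" for n
    using assms by (intro borel_compact compact_continuous_image continuous_intros closed_Int_compact compact_cball)
  ultimately show ?thesis by auto
qed

text \<open>Different values at one point differ in some coordinate \<open>k\<close>. Along a line
  in direction \<open>k\<close>, the gaps between such coordinates at different points are disjoint
  and each contains a rational, so each line meets \<open>N k\<close> in a countable set.\<close>

lemma monotone_relation_multivalued_null:
  fixes \<Gamma> :: "((real^'d) \<times> (real^'d)) set"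
  assumes cl: "closed \<Gamma>"
    and mono: "\<And>z z'. z \<in> \<Gamma> \<Longrightarrow> z' \<in> \<Gamma> \<Longrightarrow> 0 \<le> (fst z - fst z') \<bullet> (snd z - snd z')"
  shows "{x. \<exists>y y'. (x, y) \<in> \<Gamma> \<and> (x, y') \<in> \<Gamma> \<and> y \<noteq> y'} \<in> null_sets lborel"
proof -
  define N where "N k = {x. \<exists>y y'. (x, y) \<in> \<Gamma> \<and> (x, y') \<in> \<Gamma> \<and> y $ k < y' $ k}" for k
  have "N k \<in> null_sets lborel" for k
  proof (rule null_set_countable_lines)
    \<comment> \<open>Two rationals placed strictly between the coordinates replace the strict
      inequality by two closed conditions, so \<open>N k\<close> is a countable union of
      intersections of projections of closed sets.\<close>
    let ?A = "\<lambda>q. fst ` (\<Gamma> \<inter> {z. snd z $ k \<le> q})" and ?B = "\<lambda>q. fst ` (\<Gamma> \<inter> {z. q \<le> snd z $ k})"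
    let ?R = "{p \<in> \<rat> \<times> \<rat>. fst p < snd p}"
    have "N k = (\<Union>p\<in>?R. ?A (fst p) \<inter> ?B (snd p))"
    proof
      show "N k \<subseteq> (\<Union>p\<in>?R. ?A (fst p) \<inter> ?B (snd p))"
      proof
        fix x assume "x \<in> N k"
        then obtain y y' where y: "(x, y) \<in> \<Gamma>" "(x, y') \<in> \<Gamma>" "y $ k < y' $ k" by (auto simp: N_def)
        obtain q where q: "q \<in> \<rat>" "y $ k < q" "q < y' $ k" using Rats_dense_in_real[OF y(3)] by blast
        obtain r where r: "r \<in> \<rat>" "q < r" "r < y' $ k" using Rats_dense_in_real[OF q(3)] by blast
        have "x \<in> ?A q" using y q by (intro image_eqI[of _ _ "(x, y)"]) auto
        moreover have "x \<in> ?B r" using y r by (intro image_eqI[of _ _ "(x, y')"]) auto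
        ultimately show "x \<in> (\<Union>p\<in>?R. ?A (fst p) \<inter> ?B (snd p))" using q r by (intro UN_I[of "(q, r)"]) auto
      qed
      show "(\<Union>p\<in>?R. ?A (fst p) \<inter> ?B (snd p)) \<subseteq> N k"
      proof
        fix x assume "x \<in> (\<Union>p\<in>?R. ?A (fst p) \<inter> ?B (snd p))"
        then obtain p z z' where p: "fst p < snd p" "z \<in> \<Gamma>" "x = fst z" "snd z $ k \<le> fst p"
          "z' \<in> \<Gamma>" "x = fst z'" "snd p \<le> snd z' $ k" by auto
        then have "(x, snd z) \<in> \<Gamma>" "(x, snd z') \<in> \<Gamma>" "snd z $ k < snd z' $ k"
          by (metis prod.collapse, metis prod.collapse, linarith)
        then show "x \<in> N k" unfolding N_def by blast
      qed
    qed
    moreover have "countable ?R" by (rule countable_subset[of _ "\<rat> \<times> \<rat>"]) (auto simp: countable_rat)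
    moreover have "?A q \<in> sets borel" "?B q \<in> sets borel" for q
      by (auto intro!: fst_image_closed_borel closed_Int cl closed_Collect_le continuous_intros)
    ultimately show "N k \<in> sets borel" by (auto intro!: sets.countable_UN')
  next
    fix x :: "real^'d"
    let ?T = "{t. x + t *\<^sub>R axis k 1 \<in> N k}"
    have "\<forall>t\<in>?T. \<exists>y y' q. (x + t *\<^sub>R axis k 1, y) \<in> \<Gamma> \<and> (x + t *\<^sub>R axis k 1, y') \<in> \<Gamma> \<and> q \<in> \<rat> \<and> y $ k < q \<and> q < y' $ k"
    proof
      fix t assume "t \<in> ?T"
      then obtain y y' where y: "(x + t *\<^sub>R axis k 1, y) \<in> \<Gamma>" "(x + t *\<^sub>R axis k 1, y') \<in> \<Gamma>" "y $ k < y' $ k"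
        unfolding N_def by auto
      with Rats_dense_in_real[OF y(3)] show "\<exists>y y' q. (x + t *\<^sub>R axis k 1, y) \<in> \<Gamma> \<and>
          (x + t *\<^sub>R axis k 1, y') \<in> \<Gamma> \<and> q \<in> \<rat> \<and> y $ k < q \<and> q < y' $ k" by blast
    qed
    then obtain y y' q where yq: "\<And>t. t \<in> ?T \<Longrightarrow> (x + t *\<^sub>R axis k 1, y t) \<in> \<Gamma> \<and> (x + t *\<^sub>R axis k 1, y' t) \<in> \<Gamma> \<and>
        q t \<in> \<rat> \<and> y t $ k < q t \<and> q t < y' t $ k"
      by metis
    \<comment> \<open>Monotonicity is applied to the upper value at \<open>t\<close> and the lower
      value at \<open>s\<close>: the whole gap at \<open>t\<close> lies below the gap at
      \<open>s\<close>.\<close>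
    have less: "q t < q s" if "t \<in> ?T" "s \<in> ?T" "t < s" for t s
    proof -
      have "0 \<le> ((t - s) *\<^sub>R axis k 1) \<bullet> (y' t - y s)"
        using mono[of "(x + t *\<^sub>R axis k 1, y' t)" "(x + s *\<^sub>R axis k 1, y s)"] yq that by (simp add: algebra_simps)
      then have "0 \<le> (t - s) * (y' t $ k - y s $ k)" by (simp add: inner_axis')
      then have "y' t $ k \<le> y s $ k" using that by (simp add: zero_le_mult_iff)
      then show ?thesis using yq[OF that(1)] yq[OF that(2)] by linarith
    qed
    have "inj_on q ?T"
    proof (rule inj_onI)
      fix t s assume "t \<in> ?T" "s \<in> ?T" "q t = q s"
      then show "t = s" using less[of t s] less[of s t] by (metis less_irrefl linorder_neqE)
    qed
    moreover have "countable (q ` ?T)" by (rule countable_subset[OF _ countable_rat]) (use yq in blast)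
    ultimately show "countable ?T" by (metis countable_image_inj_on)
  qed
  then have "(\<Union>k. N k) \<in> null_sets lborel" by (intro null_sets_UN') (auto simp: countable_finite)
  moreover have "{x. \<exists>y y'. (x, y) \<in> \<Gamma> \<and> (x, y') \<in> \<Gamma> \<and> y \<noteq> y'} = (\<Union>k. N k)"
  proof (intro equalityI subsetI)
    fix x assume "x \<in> {x. \<exists>y y'. (x, y) \<in> \<Gamma> \<and> (x, y') \<in> \<Gamma> \<and> y \<noteq> y'}"
    then obtain y y' k where "(x, y) \<in> \<Gamma>" "(x, y') \<in> \<Gamma>" "y $ k \<noteq> y' $ k" by (auto simp: vec_eq_iff)
    then show "x \<in> (\<Union>k. N k)" unfolding N_def by (auto simp: neq_iff)
  qed (auto simp: N_def)
  ultimately show ?thesis by simp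
qed

text \<open>Off the null set, a point of \<open>\<Gamma>\<close> is determined by its first
  component, so it lies in \<open>C\<close> iff that component lies in the projection of
  \<open>\<Gamma> \<inter> C\<close>. The mass of \<open>C\<close> is thus a marginal mass, the same
  for both couplings. Closed \<open>C\<close> keep the projection Borel and suffice as a
  generator.\<close>

lemma coupling_eq_if_concentrated:
  assumes \<pi>: "\<pi> \<in> couplings \<mu> \<nu>" "\<pi>' \<in> couplings \<mu> \<nu>" and cl: "closed \<Gamma>"
    and N: "{x. \<exists>y y'. (x, y) \<in> \<Gamma> \<and> (x, y') \<in> \<Gamma> \<and> y \<noteq> y'} \<in> null_sets \<mu>" (is "?N \<in> _")
    and AE: "AE z in \<pi>. z \<in> \<Gamma>" "AE z in \<pi>'. z \<in> \<Gamma>"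
  shows "\<pi> = \<pi>'"
proof -
  have eq: "emeasure \<rho> C = emeasure \<mu> (fst ` (\<Gamma> \<inter> C))"
    if \<rho>: "\<rho> \<in> couplings \<mu> \<nu>" and AE: "AE z in \<rho>. z \<in> \<Gamma>" and C: "closed C" for \<rho> C
  proof -
    have s: "sets \<rho> = sets borel" "sets \<mu> = sets borel" using \<rho> by (auto simp: couplings_def)
    have P: "fst ` (\<Gamma> \<inter> C) \<in> sets borel" by (intro fst_image_closed_borel closed_Int cl C)
    have Nb: "?N \<in> sets borel" using N s by (auto simp: null_sets_def)
    have "?N \<times> UNIV \<in> null_sets \<rho>"
      using N Nb coupling_marginals(1)[OF \<rho> Nb] s by (auto simp: null_sets_def simp flip: borel_prod)
    then have "AE z in \<rho>. z \<notin> ?N \<times> UNIV" by (rule AE_not_in)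
    with AE have "AE z in \<rho>. z \<in> C \<longleftrightarrow> z \<in> fst ` (\<Gamma> \<inter> C) \<times> UNIV"
    proof eventually_elim
      case (elim z)
      show ?case
      proof
        assume "z \<in> C"
        then show "z \<in> fst ` (\<Gamma> \<inter> C) \<times> UNIV" using elim by (auto simp: mem_Times_iff)
      next
        assume "z \<in> fst ` (\<Gamma> \<inter> C) \<times> UNIV"
        then obtain y where y: "(fst z, y) \<in> \<Gamma>" "(fst z, y) \<in> C" by (auto simp: mem_Times_iff)
        then have "y = snd z" using elim by (cases z) auto
        then show "z \<in> C" using y by simp
      qed
    qed
    then have "emeasure \<rho> C = emeasure \<rho> (fst ` (\<Gamma> \<inter> C) \<times> UNIV)"
      using C P s by (intro emeasure_eq_AE) (auto simp: rect_borel)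
    also have "\<dots> = emeasure \<mu> (fst ` (\<Gamma> \<inter> C))" by (rule coupling_marginals(1)[OF \<rho> P])
    finally show ?thesis .
  qed
  have s: "sets \<pi> = sets borel" "sets \<pi>' = sets borel" "prob_space \<pi>" using \<pi> by (auto simp: couplings_def)
  have fin: "emeasure \<pi> UNIV \<noteq> \<infinity>"
    using prob_space.emeasure_space_1[OF s(3)] sets_eq_imp_space_eq[OF s(1)] by simp
  have sig: "sets (borel :: ((real^'a) \<times> (real^'a)) measure) = sigma_sets UNIV {C. closed C}"
    unfolding borel_eq_closed by simp
  show ?thesis
  proof (rule measure_eqI_generator_eq[where E = "{C. closed C}" and \<Omega> = UNIV and A = "\<lambda>_. UNIV"])
    show "Int_stable {C :: ((real^'a) \<times> (real^'a)) set. closed C}" by (auto simp: Int_stable_def)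
    show "emeasure \<pi> C = emeasure \<pi>' C" if "C \<in> {C. closed C}" for C
      using that eq[OF \<pi>(1) AE(1), of C] eq[OF \<pi>(2) AE(2), of C] by simp
  qed (use s fin sig in auto)
qed

lemma ennreal_half_add_half: "a * inverse 2 + a * inverse 2 = (a :: ennreal)"
proof -
  have "ennreal (1/2) + ennreal (1/2) = 1" by (subst ennreal_plus[symmetric]) auto
  then have "inverse 2 + inverse 2 = (1 :: ennreal)" by simp
  then show ?thesis by (metis distrib_left mult_1_right)
qed

text \<open>The half-sum of two measures is realised by a fair coin that selects one of them, which
  makes the formula for integrals an instance of integration against \<open>bind\<close>.\<close>

lemma coupling_midpoint:
  assumes \<pi>: "\<pi> \<in> couplings \<mu> \<nu>" "\<pi>' \<in> couplings \<mu> \<nu>"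
  obtains \<rho> where "\<rho> \<in> couplings \<mu> \<nu>"
    "\<And>f. f \<in> borel_measurable borel \<Longrightarrow> (\<integral>\<^sup>+z. f z \<partial>\<rho>) = (\<integral>\<^sup>+z. f z \<partial>\<pi>) * inverse 2 + (\<integral>\<^sup>+z. f z \<partial>\<pi>') * inverse 2"
proof -
  have p: "prob_space \<pi>" "prob_space \<pi>'" "sets \<pi> = sets borel" "sets \<pi>' = sets borel" using \<pi> by (auto simp: couplings_def)
  let ?M = "measure_pmf (bernoulli_pmf (1/2))" and ?K = "\<lambda>b. if b then \<pi> else \<pi>'"
  define \<rho> where "\<rho> = ?M \<bind> ?K"
  have K: "?K \<in> measurable ?M (subprob_algebra borel)"
    using p by (auto simp: space_subprob_algebra prob_space_imp_subprob_space)
  have s: "sets \<rho> = sets borel" unfolding \<rho>_def using K by (intro sets_bind_measurable) auto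
  have pr: "prob_space \<rho>" unfolding \<rho>_def
    using p by (intro prob_space.prob_space_bind[OF _ _ K] measure_pmf.prob_space_axioms) auto
  have int: "(\<integral>\<^sup>+z. f z \<partial>\<rho>) = (\<integral>\<^sup>+z. f z \<partial>\<pi>) * inverse 2 + (\<integral>\<^sup>+z. f z \<partial>\<pi>') * inverse 2"
    if "f \<in> borel_measurable borel" for f
    unfolding \<rho>_def nn_integral_bind[OF that K] by (subst nn_integral_bernoulli_pmf) auto
  have em: "emeasure \<rho> B = emeasure \<pi> B * inverse 2 + emeasure \<pi>' B * inverse 2" if "B \<in> sets borel" for B
    using int[of "indicator B"] that p s by simp
  have fs: "fst \<in> measurable \<rho> borel" "snd \<in> measurable \<rho> borel"
    by (auto intro!: measurable_borel_sets[OF s] borel_measurable_continuous_onI continuous_intros)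
  have sp: "space \<rho> = UNIV" using sets_eq_imp_space_eq[OF s] by simp
  have ms: "sets \<mu> = sets borel" "sets \<nu> = sets borel" using \<pi> by (auto simp: couplings_def)
  have "distr \<rho> borel fst = \<mu>"
  proof (rule measure_eqI)
    fix E assume "E \<in> sets (distr \<rho> borel fst)"
    then have E: "E \<in> sets borel" by simp
    have "fst -` E \<inter> space \<rho> = E \<times> UNIV" by (auto simp: sp)
    then show "emeasure (distr \<rho> borel fst) E = emeasure \<mu> E"
      using E by (simp add: emeasure_distr[OF fs(1)] em rect_borel coupling_marginals(1)[OF \<pi>(1)] coupling_marginals(1)[OF \<pi>(2)] ennreal_half_add_half)
  qed (simp add: ms)
  moreover have "distr \<rho> borel snd = \<nu>"
  proof (rule measure_eqI)
    fix E assume "E \<in> sets (distr \<rho> borel snd)"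
    then have E: "E \<in> sets borel" by simp
    have "snd -` E \<inter> space \<rho> = UNIV \<times> E" by (auto simp: sp)
    then show "emeasure (distr \<rho> borel snd) E = emeasure \<nu> E"
      using E by (simp add: emeasure_distr[OF fs(2)] em rect_borel coupling_marginals(2)[OF \<pi>(1)] coupling_marginals(2)[OF \<pi>(2)] ennreal_half_add_half)
  qed (simp add: ms)
  ultimately have "\<rho> \<in> couplings \<mu> \<nu>" using s pr by (simp add: couplings_def)
  then show thesis using int that by blast
qed

text \<open>The cost is affine, so the midpoint of two optimal couplings is optimal and its support
  is monotone. Sets null for the midpoint are null for both couplings, hence this one support
  carries both.\<close>

theorem optimal_coupling_unique:
  assumes P2: "\<mu> \<in> P2" "\<nu> \<in> P2" and ac: "absolutely_continuous lborel \<mu>"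
  shows "\<exists>!\<pi>. \<pi> \<in> optimal_couplings \<mu> \<nu>"
proof (rule ex_ex1I)
  show "\<exists>\<pi>. \<pi> \<in> optimal_couplings \<mu> \<nu>" using P2 by (intro optimal_coupling_exists) (auto simp: P2_def)
next
  fix \<pi> \<pi>' assume opt: "\<pi> \<in> optimal_couplings \<mu> \<nu>" "\<pi>' \<in> optimal_couplings \<mu> \<nu>"
  let ?I = "INF \<pi>\<in>couplings \<mu> \<nu>. transport_cost \<pi>"
  have C: "\<pi> \<in> couplings \<mu> \<nu>" "\<pi>' \<in> couplings \<mu> \<nu>" and I: "transport_cost \<pi> = ?I" "transport_cost \<pi>' = ?I"
    using opt by (auto simp: optimal_couplings_def)
  obtain \<rho> where \<rho>: "\<rho> \<in> couplings \<mu> \<nu>" and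
    int: "\<And>f. f \<in> borel_measurable borel \<Longrightarrow> (\<integral>\<^sup>+z. f z \<partial>\<rho>) = (\<integral>\<^sup>+z. f z \<partial>\<pi>) * inverse 2 + (\<integral>\<^sup>+z. f z \<partial>\<pi>') * inverse 2"
    by (rule coupling_midpoint[OF C]) blast
  have "transport_cost \<rho> = transport_cost \<pi> * inverse 2 + transport_cost \<pi>' * inverse 2"
    unfolding transport_cost_def case_prod_beta
    by (intro int measurable_compose[OF _ measurable_ennreal] borel_measurable_continuous_onI continuous_intros)
  also have "\<dots> = ?I" unfolding I by (rule ennreal_half_add_half)
  finally have \<rho>_opt: "\<rho> \<in> optimal_couplings \<mu> \<nu>" using \<rho> by (simp add: optimal_couplings_def)
  have s: "sets \<rho> = sets borel" "sets \<pi> = sets borel" "sets \<pi>' = sets borel" using \<rho> C by (auto simp: couplings_def)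
  let ?\<Gamma> = "measure_support \<rho>"
  have cl: "closed ?\<Gamma>" by (rule closed_measure_support)
  have "AE z in \<rho>. z \<in> ?\<Gamma>" using s(1) by (rule AE_measure_support)
  then have "(\<integral>\<^sup>+z. indicator (- ?\<Gamma>) z \<partial>\<rho>) = 0"
    using cl s by (subst nn_integral_0_iff_AE) (auto simp: indicator_def elim!: eventually_mono)
  then have "(\<integral>\<^sup>+z. indicator (- ?\<Gamma>) z \<partial>\<pi>) = 0" "(\<integral>\<^sup>+z. indicator (- ?\<Gamma>) z \<partial>\<pi>') = 0"
    using int[of "indicator (- ?\<Gamma>)"] cl by auto
  then have "emeasure \<pi> (- ?\<Gamma>) = 0" "emeasure \<pi>' (- ?\<Gamma>) = 0" using cl s by auto
  then have "- ?\<Gamma> \<in> null_sets \<pi>" "- ?\<Gamma> \<in> null_sets \<pi>'" using cl s by (auto simp: null_sets_def)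
  then have AE: "AE z in \<pi>. z \<in> ?\<Gamma>" "AE z in \<pi>'. z \<in> ?\<Gamma>" by (auto dest: AE_not_in)
  have "{x. \<exists>y y'. (x, y) \<in> ?\<Gamma> \<and> (x, y') \<in> ?\<Gamma> \<and> y \<noteq> y'} \<in> null_sets lborel"
    by (rule monotone_relation_multivalued_null[OF cl optimal_coupling_support_monotone[OF \<rho>_opt P2]])
  then have "{x. \<exists>y y'. (x, y) \<in> ?\<Gamma> \<and> (x, y') \<in> ?\<Gamma> \<and> y \<noteq> y'} \<in> null_sets \<mu>"
    using ac by (auto simp: absolutely_continuous_def)
  then show "\<pi> = \<pi>'" using coupling_eq_if_concentrated[OF C cl _ AE] by blast
qed

section \<open>Pushing forward along a matrix\<close>

lemma continuous_on_matrix_vector_mult [continuous_intros]: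
  fixes B :: "real^'n^'m"
  assumes "continuous_on S f"
  shows "continuous_on S (\<lambda>x. B *v f x)"
  by (rule bounded_linear.continuous_on[OF matrix_vector_mul_bounded_linear assms])

lemma borel_measurable_matrix_vector_mult: "(*v) B \<in> borel_measurable (borel :: (real^'n) measure)"
  for B :: "real^'n^'m"
  by (intro borel_measurable_continuous_onI continuous_intros)

lemma push_P2:
  assumes "\<mu> \<in> P2"
  shows "push B \<mu> \<in> P2"
proof -
  have \<mu>: "prob_space \<mu>" "sets \<mu> = sets borel" "(\<integral>\<^sup>+x. ennreal ((norm x)\<^sup>2) \<partial>\<mu>) < \<infinity>" using assms by (auto simp: P2_def)
  have B: "(*v) B \<in> borel_measurable \<mu>" by (rule measurable_borel_sets[OF \<mu>(2) borel_measurable_matrix_vector_mult])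
  obtain K where K: "\<And>x. norm (B *v x) \<le> norm x * K"
    using bounded_linear.bounded[OF matrix_vector_mul_bounded_linear[of B]] by blast
  have n: "(\<lambda>x. ennreal ((norm x)\<^sup>2)) \<in> borel_measurable \<mu>"
    by (intro measurable_borel_sets[OF \<mu>(2)]) measurable
  have "(\<integral>\<^sup>+x. ennreal ((norm x)\<^sup>2) \<partial>push B \<mu>) = (\<integral>\<^sup>+x. ennreal ((norm (B *v x))\<^sup>2) \<partial>\<mu>)"
    unfolding push_def by (rule nn_integral_distr[OF B]) measurable
  also have "\<dots> \<le> (\<integral>\<^sup>+x. ennreal (K\<^sup>2) * ennreal ((norm x)\<^sup>2) \<partial>\<mu>)"
  proof (intro nn_integral_mono)
    fix x
    have "(norm (B *v x))\<^sup>2 \<le> (norm x * K)\<^sup>2" by (intro power_mono K) simp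
    then show "ennreal ((norm (B *v x))\<^sup>2) \<le> ennreal (K\<^sup>2) * ennreal ((norm x)\<^sup>2)"
      by (simp add: power_mult_distrib mult.commute flip: ennreal_mult)
  qed
  also have "\<dots> = ennreal (K\<^sup>2) * (\<integral>\<^sup>+x. ennreal ((norm x)\<^sup>2) \<partial>\<mu>)" by (rule nn_integral_cmult[OF n])
  also have "\<dots> < \<infinity>" using \<mu>(3) by (simp add: ennreal_mult_less_top)
  finally show ?thesis
    using prob_space.prob_space_distr[OF \<mu>(1) B] by (simp add: P2_def push_def)
qed

lemma matrix_inv_mult:
  assumes "invertible A"
  shows "A ** matrix_inv A = mat 1" "matrix_inv A ** A = mat 1"
  using someI_ex[OF assms[unfolded invertible_def]] by (auto simp: matrix_inv_def)

text \<open>The preimage of a null set under \<open>B\<close> is its image under the inverse matrix,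
  and linear maps of a space to itself preserve negligible sets.\<close>

lemma absolutely_continuous_push:
  assumes inv: "invertible B" and s: "sets \<mu> = sets borel" and ac: "absolutely_continuous lborel \<mu>"
  shows "absolutely_continuous lborel (push B \<mu>)"
  unfolding absolutely_continuous_def
proof
  fix N assume N: "N \<in> null_sets (lborel :: (real^'a) measure)"
  have B: "(*v) B \<in> borel_measurable borel" by (rule borel_measurable_matrix_vector_mult)
  have Nb: "N \<in> sets borel" using N by (auto simp: null_sets_def)
  have mm: "B *v (matrix_inv B *v x) = x" "matrix_inv B *v (B *v x) = x" for x
    using matrix_inv_mult[OF inv] by (simp_all add: matrix_vector_mul_assoc)
  have "negligible N" unfolding negligible_iff_null_sets using N by (rule null_sets_completionI)
  then have "negligible ((*v) (matrix_inv B) ` N)"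
    by (intro negligible_differentiable_image_negligible linear_imp_differentiable_on matrix_vector_mul_linear) auto
  moreover have "(*v) (matrix_inv B) ` N = (*v) B -` N"
    using mm by (auto simp: image_iff) metis
  ultimately have "(*v) B -` N \<in> null_sets lebesgue" by (simp add: negligible_iff_null_sets)
  \<comment> \<open>Negligibility refers to the completed measure; Borel measurability of the
    preimage brings the statement back to \<open>lborel\<close>.\<close>
  moreover have Bb: "(*v) B -` N \<in> sets borel" using measurable_sets[OF B Nb] by simp
  ultimately have "(*v) B -` N \<in> null_sets lborel" by (auto simp: null_sets_def)
  then have "(*v) B -` N \<in> null_sets \<mu>" using ac by (auto simp: absolutely_continuous_def)
  then show "N \<in> null_sets (push B \<mu>)"
    unfolding push_def using Nb sets_eq_imp_space_eq[OF s]
    by (subst null_sets_distr_iff[OF measurable_borel_sets[OF s B]]) auto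
qed

lemma push_push: "sets \<mu> = sets borel \<Longrightarrow> push B (push A \<mu>) = push (B ** A) \<mu>"
  unfolding push_def
  by (subst distr_distr) (auto intro!: measurable_borel_sets borel_measurable_matrix_vector_mult
      simp: o_def matrix_vector_mul_assoc)

lemma push_mat_1: "sets \<mu> = sets borel \<Longrightarrow> push (mat 1) \<mu> = \<mu>"
  unfolding push_def using distr_id2[of borel \<mu>] by (simp add: fun_eq_iff[of "(*v) (mat 1)" "\<lambda>x. x", THEN iffD2])

lemma measurable_push_fst:
  fixes B :: "real^'n^'m"
  shows "(\<lambda>z :: (real^'n) \<times> 'b::topological_space. (B *v fst z, snd z)) \<in> borel_measurable borel"
  by (intro borel_measurable_continuous_onI continuous_intros)

lemma push_fst_push_fst: "sets \<eta> = sets borel \<Longrightarrow> push_fst B (push_fst A \<eta>) = push_fst (B ** A) \<eta>"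
  unfolding push_fst_def case_prod_beta'
  by (subst distr_distr) (auto intro!: measurable_borel_sets measurable_push_fst simp: o_def matrix_vector_mul_assoc)

lemma push_fst_mat_1: "sets \<eta> = sets borel \<Longrightarrow> push_fst (mat 1) \<eta> = \<eta>"
  unfolding push_fst_def using distr_id2[of borel \<eta>] by (simp add: id_def)

lemma push_fst_coupling:
  assumes "\<eta> \<in> couplings \<mu> \<nu>"
  shows "push_fst B \<eta> \<in> couplings (push B \<mu>) \<nu>"
proof -
  have \<eta>: "prob_space \<eta>" "sets \<eta> = sets borel" "\<mu> = distr \<eta> borel fst" "\<nu> = distr \<eta> borel snd"
    using assms by (auto simp: couplings_def)
  have m: "(\<lambda>z. (B *v fst z, snd z)) \<in> borel_measurable \<eta>"
    by (rule measurable_borel_sets[OF \<eta>(2) measurable_push_fst])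
  have "distr (push_fst B \<eta>) borel fst = push B \<mu>"
    unfolding push_fst_def case_prod_beta' push_def \<eta>(3)
    by (subst (1 2) distr_distr) (auto intro!: m borel_measurable_matrix_vector_mult coupling_measurable[OF assms]
        borel_measurable_continuous_onI continuous_intros simp: o_def)
  moreover have "distr (push_fst B \<eta>) borel snd = \<nu>"
    unfolding push_fst_def case_prod_beta' \<eta>(4)
    by (subst distr_distr) (auto intro!: m borel_measurable_continuous_onI continuous_intros simp: o_def)
  moreover have "prob_space (push_fst B \<eta>)"
    unfolding push_fst_def case_prod_beta' by (rule prob_space.prob_space_distr[OF \<eta>(1) m])
  ultimately show ?thesis by (simp add: couplings_def push_fst_def)
qed

text \<open>\<open>push_fst A\<close> and \<open>push_fst (matrix_inv A)\<close> are mutually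
  inverse between couplings of \<open>\<mu>\<close> and those of \<open>push A \<mu>\<close>, so
  uniqueness transfers from the source \<open>push A \<mu>\<close>.\<close>

lemma push_fst_optimal_unique:
  assumes P2: "\<mu> \<in> P2" "\<nu> \<in> P2" and ac: "absolutely_continuous lborel \<mu>" and inv: "invertible A"
  shows "\<exists>!\<eta>. \<eta> \<in> couplings \<mu> \<nu> \<and> push_fst A \<eta> \<in> optimal_couplings (push A \<mu>) \<nu>"
proof -
  have s: "sets \<mu> = sets borel" using P2 by (simp add: P2_def)
  have "\<exists>!\<pi>. \<pi> \<in> optimal_couplings (push A \<mu>) \<nu>"
    by (intro optimal_coupling_unique push_P2 P2 absolutely_continuous_push inv s ac)
  then obtain \<pi> where \<pi>: "\<pi> \<in> optimal_couplings (push A \<mu>) \<nu>" and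
    uniq: "\<And>\<pi>'. \<pi>' \<in> optimal_couplings (push A \<mu>) \<nu> \<Longrightarrow> \<pi>' = \<pi>" by blast
  have \<pi>C: "\<pi> \<in> couplings (push A \<mu>) \<nu>" using \<pi> by (simp add: optimal_couplings_def)
  have s\<pi>: "sets \<pi> = sets borel" using \<pi>C by (simp add: couplings_def)
  note AA = matrix_inv_mult[OF inv]
  show ?thesis
  proof (intro ex1I[of _ "push_fst (matrix_inv A) \<pi>"] conjI)
    show "push_fst (matrix_inv A) \<pi> \<in> couplings \<mu> \<nu>"
      using push_fst_coupling[OF \<pi>C, of "matrix_inv A"] by (simp add: push_push[OF s] AA push_mat_1[OF s])
    show "push_fst A (push_fst (matrix_inv A) \<pi>) \<in> optimal_couplings (push A \<mu>) \<nu>"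
      using \<pi> by (simp add: push_fst_push_fst[OF s\<pi>] AA push_fst_mat_1[OF s\<pi>])
  next
    fix \<eta> assume \<eta>: "\<eta> \<in> couplings \<mu> \<nu> \<and> push_fst A \<eta> \<in> optimal_couplings (push A \<mu>) \<nu>"
    then have s\<eta>: "sets \<eta> = sets borel" by (simp add: couplings_def)
    have "push_fst (matrix_inv A) (push_fst A \<eta>) = \<eta>"
      by (simp add: push_fst_push_fst[OF s\<eta>] AA push_fst_mat_1[OF s\<eta>])
    then show "\<eta> = push_fst (matrix_inv A) \<pi>" using uniq \<eta> by metis
  qed
qed

section \<open>The first order condition\<close>

lemma push_fst_cost:
  assumes \<eta>: "\<eta> \<in> couplings \<mu> \<nu>" and P2: "\<mu> \<in> P2" "\<nu> \<in> P2"
  shows "integrable \<eta> (\<lambda>z. (norm (B *v fst z - snd z))\<^sup>2)"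
    and "transport_cost (push_fst B \<eta>) = ennreal (\<integral>z. (norm (B *v fst z - snd z))\<^sup>2 \<partial>\<eta>)"
proof -
  have s: "sets \<eta> = sets borel" using \<eta> by (simp add: couplings_def)
  have m: "(\<lambda>z. (B *v fst z, snd z)) \<in> borel_measurable \<eta>"
    by (rule measurable_borel_sets[OF s measurable_push_fst])
  have c: "(\<lambda>z :: (real^'a) \<times> (real^'a). (norm (fst z - snd z))\<^sup>2) \<in> borel_measurable borel"
    by (intro borel_measurable_continuous_onI continuous_intros)
  note t = transport_cost_coupling[OF push_fst_coupling[OF \<eta>] push_P2[OF P2(1)] P2(2), of B]
  show "integrable \<eta> (\<lambda>z. (norm (B *v fst z - snd z))\<^sup>2)"
    using t(1) unfolding push_fst_def case_prod_beta' integrable_distr_eq[OF m c] by simp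
  show "transport_cost (push_fst B \<eta>) = ennreal (\<integral>z. (norm (B *v fst z - snd z))\<^sup>2 \<partial>\<eta>)"
    unfolding t(2) unfolding push_fst_def case_prod_beta' integral_distr[OF m c] by simp
qed

lemma W2_power2: "(W2 \<mu> \<nu>)\<^sup>2 = enn2real (INF \<pi>\<in>couplings \<mu> \<nu>. transport_cost \<pi>)"
  by (simp add: W2_def)

text \<open>A single \<open>\<eta>\<close> supplies a competitor for every matrix \<open>B\<close>,
  so a function quadratic in \<open>B\<close> dominates the squared distance.\<close>

lemma W2_push_le:
  assumes "\<eta> \<in> couplings \<mu> \<nu>" "\<mu> \<in> P2" "\<nu> \<in> P2"
  shows "(W2 (push B \<mu>) \<nu>)\<^sup>2 \<le> (\<integral>z. (norm (B *v fst z - snd z))\<^sup>2 \<partial>\<eta>)"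
proof -
  have "(INF \<pi>\<in>couplings (push B \<mu>) \<nu>. transport_cost \<pi>) \<le> transport_cost (push_fst B \<eta>)"
    by (rule INF_lower[OF push_fst_coupling[OF assms(1)]])
  then show ?thesis
    unfolding W2_power2 push_fst_cost(2)[OF assms] by (intro enn2real_leI) auto
qed

lemma W2_push_eq:
  assumes "\<eta> \<in> couplings \<mu> \<nu>" "\<mu> \<in> P2" "\<nu> \<in> P2" "push_fst B \<eta> \<in> optimal_couplings (push B \<mu>) \<nu>"
  shows "(W2 (push B \<mu>) \<nu>)\<^sup>2 = (\<integral>z. (norm (B *v fst z - snd z))\<^sup>2 \<partial>\<eta>)"
proof -
  have "(INF \<pi>\<in>couplings (push B \<mu>) \<nu>. transport_cost \<pi>) = transport_cost (push_fst B \<eta>)"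
    using assms(4) by (simp add: optimal_couplings_def)
  then show ?thesis unfolding W2_power2 push_fst_cost(2)[OF assms(1-3)] by simp
qed

text \<open>The matrix is the unit e_j e_k^T, the direction of perturbation that isolates the entry
  (j, k) of the first order condition.\<close>

lemma matrix_unit_mult:
  fixes x :: "real^'d"
  shows "(\<chi> a b. if a = j \<and> b = k then 1 else 0) *v x = x $ k *\<^sub>R axis j (1::real)"
proof -
  have "(\<Sum>b\<in>UNIV. (if a = j \<and> b = k then 1 else 0) * x $ b) = (if a = j then x $ k else 0)" for a
    by (cases "a = j") (auto simp: if_distrib[of "\<lambda>c. c * _"] cong: if_cong)
  then show ?thesis by (simp add: vec_eq_iff matrix_vector_mult_def axis_def)
qed

text \<open>This integrates the expansion of |Ax - y + t x_k e_j|^2. Half the coefficient of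
  \<open>t\<close> is the entry (j, k) of the integral of (Ax - y) x^T.\<close>

lemma quadratic_perturbation:
  fixes \<mu> \<nu> :: "(real^'d) measure" and j k :: 'd
  assumes \<eta>: "\<eta> \<in> couplings \<mu> \<nu>" and P2: "\<mu> \<in> P2" "\<nu> \<in> P2"
  defines "E \<equiv> (\<chi> a b. if a = j \<and> b = k then 1 else 0) :: real^'d^'d"
  shows "(\<integral>z. (norm ((A + t *\<^sub>R E) *v fst z - snd z))\<^sup>2 \<partial>\<eta>) =
    (\<integral>z. (norm (A *v fst z - snd z))\<^sup>2 \<partial>\<eta>) + 2 * t * (\<integral>z. (A *v fst z - snd z) $ j * fst z $ k \<partial>\<eta>) +
    t\<^sup>2 * (\<integral>z. (fst z $ k)\<^sup>2 \<partial>\<eta>)"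
proof -
  have comp: "\<bar>x $ i\<bar> \<le> norm x" for x :: "real^'d" and i by (rule component_le_norm_cart)
  have ik: "integrable \<eta> (\<lambda>z. (fst z $ k)\<^sup>2)"
  proof (rule coupling_integrable_quadratic[OF \<eta> P2])
    show "continuous_on UNIV (\<lambda>z :: (real^'d) \<times> (real^'d). (fst z $ k)\<^sup>2)" by (intro continuous_intros)
    show "\<bar>(fst z $ k)\<^sup>2\<bar> \<le> 1 * ((norm (fst z))\<^sup>2 + (norm (snd z))\<^sup>2)" for z :: "(real^'d) \<times> (real^'d)"
      using power_mono[OF comp[of "fst z" k], of 2] by (simp add: add_increasing2)
  qed
  obtain K where K: "\<And>x. norm (A *v x) \<le> norm x * K" "0 < K"
    using bounded_linear.pos_bounded[OF matrix_vector_mul_bounded_linear[of A]] by blast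
  have ijk: "integrable \<eta> (\<lambda>z. (A *v fst z - snd z) $ j * fst z $ k)"
  proof (rule coupling_integrable_quadratic[OF \<eta> P2])
    show "continuous_on UNIV (\<lambda>z :: (real^'d) \<times> (real^'d). (A *v fst z - snd z) $ j * fst z $ k)"
      by (intro continuous_intros)
    fix z :: "(real^'d) \<times> (real^'d)"
    have "\<bar>(A *v fst z - snd z) $ j * fst z $ k\<bar> \<le> norm (A *v fst z - snd z) * norm (fst z)"
      unfolding abs_mult by (intro mult_mono comp) auto
    also have "\<dots> \<le> (norm (fst z) * K + norm (snd z)) * norm (fst z)"
      using norm_triangle_ineq4[of "A *v fst z" "snd z"] K(1)[of "fst z"] by (intro mult_right_mono) auto
    also have "\<dots> = K * (norm (fst z))\<^sup>2 + norm (fst z) * norm (snd z)"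
      by (simp add: power2_eq_square algebra_simps)
    also have "norm (fst z) * norm (snd z) \<le> (norm (fst z))\<^sup>2 + (norm (snd z))\<^sup>2"
      using sum_squares_bound[of "norm (fst z)" "norm (snd z)"] zero_le_power2[of "norm (fst z)"] zero_le_power2[of "norm (snd z)"]
      by linarith
    also have "K * (norm (fst z))\<^sup>2 + ((norm (fst z))\<^sup>2 + (norm (snd z))\<^sup>2) \<le> (K + 1) * ((norm (fst z))\<^sup>2 + (norm (snd z))\<^sup>2)"
      using K(2) by (simp add: algebra_simps)
    finally show "\<bar>(A *v fst z - snd z) $ j * fst z $ k\<bar> \<le> (K + 1) * ((norm (fst z))\<^sup>2 + (norm (snd z))\<^sup>2)" by simp
  qed
  have "(norm ((A + t *\<^sub>R E) *v x - y))\<^sup>2 = (norm (A *v x - y))\<^sup>2 + 2 * t * ((A *v x - y) $ j * x $ k) + t\<^sup>2 * (x $ k)\<^sup>2" for x y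
  proof -
    have "(A + t *\<^sub>R E) *v x - y = (A *v x - y) + (t * x $ k) *\<^sub>R axis j 1"
      unfolding matrix_vector_mult_add_rdistrib E_def
      by (simp add: scaleR_matrix_vector_assoc[symmetric] matrix_unit_mult)
    then show ?thesis
      by (simp only: power2_norm_eq_inner inner_add_left inner_add_right inner_scaleR_left inner_scaleR_right inner_axis inner_axis')
        (simp add: power2_eq_square axis_def algebra_simps)
  qed
  then show ?thesis using ik ijk push_fst_cost(1)[OF \<eta> P2, of A] by simp
qed

lemma quadratic_nonneg_imp_linear_zero:
  fixes S C :: real
  assumes "\<And>t. 0 \<le> 2 * t * S + t\<^sup>2 * C" "0 \<le> C"
  shows "S = 0"
proof -
  \<comment> \<open>The parabola is tested at \<open>- r\<close>, where its value is - r^2 (C + 2).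
    The denominator is \<open>C + 1\<close> instead of \<open>C\<close> so that \<open>C = 0\<close>
    is covered.\<close>
  define r where "r = S / (C + 1)"
  have S: "S = r * (C + 1)" using assms(2) by (simp add: r_def)
  have "0 \<le> 2 * (- r) * S + (- r)\<^sup>2 * C" by (rule assms(1))
  then have "r\<^sup>2 * (C + 2) \<le> 0" unfolding S by (simp add: power2_eq_square algebra_simps)
  then have "r = 0" using assms(2) by (simp add: mult_le_0_iff)
  then show ?thesis by (simp add: S)
qed

text \<open>The second conjunct speaks of an arbitrary family with the defining property; by the
  first conjunct its members are determined for all indices in the sum.\<close>

theorem theorem2:
  fixes m :: nat
    and \<mu> :: "nat \<Rightarrow> (real^'d) measure"
    and A :: "real^'d^'d"
  assumes "\<And>i. i \<in> {1..m} \<Longrightarrow> \<mu> i \<in> P2"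
    and "\<And>i. i \<in> {1..m} \<Longrightarrow> absolutely_continuous lborel (\<mu> i)"
    and "\<And>B :: real^'d^'d. F m \<mu> A \<le> F m \<mu> B"
    and "invertible A"
  shows "(\<forall>i\<in>{1..<m}. \<exists>!\<eta>. \<eta> \<in> couplings (\<mu> i) (\<mu> (Suc i)) \<and>
            push_fst A \<eta> \<in> optimal_couplings (push A (\<mu> i)) (\<mu> (Suc i))) \<and>
         (\<forall>\<eta>. (\<forall>i\<in>{1..<m}. \<eta> i \<in> couplings (\<mu> i) (\<mu> (Suc i)) \<and>
                 push_fst A (\<eta> i) \<in> optimal_couplings (push A (\<mu> i)) (\<mu> (Suc i))) \<longrightarrow>
            (\<Sum>i\<in>{1..<m}. matrix_integral (\<eta> i) (\<lambda>(x, y). outer_product (A *v x - y) x)) = 0)"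
proof (intro conjI ballI allI impI)
  fix i assume i: "i \<in> {1..<m}"
  show "\<exists>!\<eta>. \<eta> \<in> couplings (\<mu> i) (\<mu> (Suc i)) \<and>
            push_fst A \<eta> \<in> optimal_couplings (push A (\<mu> i)) (\<mu> (Suc i))"
    using i by (intro push_fst_optimal_unique assms) auto
next
  fix \<eta> assume \<eta>: "\<forall>i\<in>{1..<m}. \<eta> i \<in> couplings (\<mu> i) (\<mu> (Suc i)) \<and>
                 push_fst A (\<eta> i) \<in> optimal_couplings (push A (\<mu> i)) (\<mu> (Suc i))"
  have C: "\<eta> i \<in> couplings (\<mu> i) (\<mu> (Suc i))" "\<mu> i \<in> P2" "\<mu> (Suc i) \<in> P2" if "i \<in> {1..<m}" for i
    using \<eta> assms(1) that by auto
  have "(\<Sum>i\<in>{1..<m}. \<integral>z. (A *v fst z - snd z) $ j * fst z $ k \<partial>\<eta> i) = 0" for j k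
  proof (rule quadratic_nonneg_imp_linear_zero)
    let ?J = "\<lambda>B i. \<integral>z. (norm (B *v fst z - snd z))\<^sup>2 \<partial>\<eta> i"
    let ?C = "\<Sum>i\<in>{1..<m}. \<integral>z. (fst z $ k)\<^sup>2 \<partial>\<eta> i"
    let ?E = "(\<chi> a b. if a = j \<and> b = k then 1 else 0) :: real^'d^'d"
    fix t :: real
    \<comment> \<open>Optimality of the pushed couplings gives equality at \<open>A\<close>. At the
      perturbed matrix they are only competitors, and the upper bound this gives is all that the
      comparison uses.\<close>
    have "(\<Sum>i\<in>{1..<m}. ?J A i) = F m \<mu> A"
      unfolding F_def using \<eta> C by (intro sum.cong refl W2_push_eq[symmetric]) auto
    also have "\<dots> \<le> F m \<mu> (A + t *\<^sub>R ?E)" by (rule assms(3))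
    also have "\<dots> \<le> (\<Sum>i\<in>{1..<m}. ?J (A + t *\<^sub>R ?E) i)"
      unfolding F_def using C by (intro sum_mono W2_push_le) auto
    also have "\<dots> = (\<Sum>i\<in>{1..<m}. ?J A i + 2 * t * (\<integral>z. (A *v fst z - snd z) $ j * fst z $ k \<partial>\<eta> i) +
        t\<^sup>2 * (\<integral>z. (fst z $ k)\<^sup>2 \<partial>\<eta> i))"
      using C by (intro sum.cong refl quadratic_perturbation) auto
    finally show "0 \<le> 2 * t * (\<Sum>i\<in>{1..<m}. \<integral>z. (A *v fst z - snd z) $ j * fst z $ k \<partial>\<eta> i) + t\<^sup>2 * ?C"
      by (simp add: sum.distrib sum_distrib_left)
  qed (intro sum_nonneg integral_nonneg_AE, simp)
  then show "(\<Sum>i\<in>{1..<m}. matrix_integral (\<eta> i) (\<lambda>(x, y). outer_product (A *v x - y) x)) = 0"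
    by (simp add: vec_eq_iff matrix_integral_def outer_product_def case_prod_beta)
qed

end
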